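(* Let $(X,d)$ be a proper, roughly geodesic, strongly hyperbolic metric space with base point $o\in X$, and let $\Gamma$ be a non-elementary discrete group of isometries of $(X,d)$ acting cocompactly on $X$. Then there exist (sufficiently large) constants $R,C>0$ such that for every $s\in[0,1]$, every integer $n\ge0$, and every finitely supported function $f:\Gamma\to\mathbb{C}$ with support in $S^\Gamma_{n,R}=\{\gamma\in\Gamma: nR\le d(o,\gamma o)<(n+1)R\}$, $$\|\pi_s(f)\|_{op}\le C\big(1+\omega_{|s-\frac12|}(nR)\big)\|f\|_2,$$ where $\pi_s(f)=\sum_{\gamma}f(\gamma)\pi_s(\gamma)$ is an operator on $L^2(\partial X,\nu_o)$ and $\|f\|_2$ is the $\ell^2(\Gamma)$-norm.
   Context: Gromov product: $(x,y)_o=\frac12(d(x,o)+d(y,o)-d(x,y))$. $(X,d)$ is strongly hyperbolic if for some $\epsilon>0$, $e^{-\epsilon(x,y)_o}\le e^{-\epsilon(x,z)_o}+e^{-\epsilon(z,y)_o}$ for all $x,y,z,o\in X$. It is then Gromov hyperbolic, the Gromov product extends continuously to $X\cup\partial X$ ($\partial X$ the Gromov boundary), and $d_o(\xi,\eta)=e^{-\epsilon(\xi,\eta)_o}$ is a metric on $\partial X$. Roughly geodesic: there is $C_X>0$ such that any $x,y\in X$ are joined by a map $r:[a,b]\to X$, $r(a)=x$, $r(b)=y$, with $|t-u|-C_X\le d(r(t),r(u))\le|t-u|+C_X$. A discrete group of isometries is one acting properly discontinuously. Volume growth: $\alpha=\limsup_{T\to\infty}\frac1T\log|\Gamma o\cap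 B_X(o,T)|$. Busemann function: $\beta_\xi(x,y)=2(\xi,y)_x-d(x,y)$ for $\xi\in\partial X$, $x,y\in X$. The Patterson–Sullivan measure $\nu_o$ is the Hausdorff measure of dimension $\alpha/\epsilon$ on $(\partial X,d_o)$ normalized to be a probability measure; it satisfies $\frac{d\gamma_*\nu_o}{d\nu_o}(\xi)=e^{\alpha\beta_\xi(o,\gamma o)}$. Boundary representations, for $s\in\mathbb{R}$: $\pi_s(\gamma)v(\xi)=\big(\frac{d\gamma_*\nu_o}{d\nu_o}(\xi)\big)^s v(\gamma^{-1}\xi)$ for $v\in L^2(\partial X,\nu_o)$. For $t\ge0$: $\omega_\sigma(t)=\frac{2\sinh(\sigma\alpha t)}{1-e^{-2\sigma\alpha}}$ if $\sigma\ne0$, and $\omega_0(t)=t$. *)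

theory Defs
  imports "HOL-Analysis.Analysis" "HOL-Algebra.Bij"
begin

section \<open>Hyperbolic metric spaces\<close>

definition gromov_prod :: "'a::metric_space \<Rightarrow> 'a \<Rightarrow> 'a \<Rightarrow> real" where
  "gromov_prod p x y = (dist x p + dist y p - dist x y) / 2"

definition proper_space :: "'a::metric_space itself \<Rightarrow> bool" where
  "proper_space _ \<longleftrightarrow> (\<forall>(x::'a) r. compact (cball x r))"

definition roughly_geodesic :: "'a::metric_space itself \<Rightarrow> bool" where
  "roughly_geodesic _ \<longleftrightarrow> (\<exists>C>0. \<forall>x y :: 'a. \<exists>(a::real) b r. a \<le> b \<and> r a = x \<and> r b = y \<and>
     (\<forall>t\<in>{a..b}. \<forall>u\<in>{a..b}.
        \<bar>t - u\<bar> - C \<le> dist (r t) (r u) \<and> dist (r t) (r u) \<le> \<bar>t - u\<bar> + C))"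

text \<open>A space is strongly hyperbolic if this holds for some \<open>\<epsilon> > 0\<close>; the parameter is kept
  explicit because the metric on the boundary depends on it.\<close>

definition strongly_hyperbolic :: "'a::metric_space itself \<Rightarrow> real \<Rightarrow> bool" where
  "strongly_hyperbolic _ \<epsilon> \<longleftrightarrow> (\<forall>x y z p :: 'a.
     exp (- \<epsilon> * gromov_prod p x y)
       \<le> exp (- \<epsilon> * gromov_prod p x z) + exp (- \<epsilon> * gromov_prod p z y))"


section \<open>The Gromov boundary\<close>

definition gromov_seqs :: "'a::metric_space \<Rightarrow> (nat \<Rightarrow> 'a) set" where
  "gromov_seqs p = {u. filterlim (\<lambda>(m, n). gromov_prod p (u m) (u n)) at_top
     (sequentially \<times>\<^sub>F sequentially)}"

definition gromov_rel :: "'a::metric_space \<Rightarrow> ((nat \<Rightarrow> 'a) \<times> (nat \<Rightarrow> 'a)) set" where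
  "gromov_rel p = {(u, v). u \<in> gromov_seqs p \<and> v \<in> gromov_seqs p \<and>
     filterlim (\<lambda>(m, n). gromov_prod p (u m) (v n)) at_top (sequentially \<times>\<^sub>F sequentially)}"

type_synonym 'a bpoint = "(nat \<Rightarrow> 'a) set"

definition gromov_boundary :: "'a::metric_space \<Rightarrow> 'a bpoint set" where
  "gromov_boundary p = gromov_seqs p // gromov_rel p"

text \<open>The continuous extension of the Gromov product to the boundary. In a strongly hyperbolic space
  the limit exists and does not depend on the representing sequences
  (lemma \<open>gromov_prod_bdry_tendsto\<close> below); it is \<open>\<infinity>\<close> on the diagonal.\<close>

definition gromov_prod_bdry :: "'a::metric_space \<Rightarrow> 'a bpoint \<Rightarrow> 'a bpoint \<Rightarrow> ereal" where
  "gromov_prod_bdry p \<xi> \<eta> = (THE l. \<forall>u\<in>\<xi>. \<forall>v\<in>\<eta>.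
     ((\<lambda>(m, n). ereal (gromov_prod p (u m) (v n))) \<longlongrightarrow> l) (sequentially \<times>\<^sub>F sequentially))"

definition visual_dist :: "'a::metric_space \<Rightarrow> real \<Rightarrow> 'a bpoint \<Rightarrow> 'a bpoint \<Rightarrow> real" where
  "visual_dist p \<epsilon> \<xi> \<eta> = (if gromov_prod_bdry p \<xi> \<eta> = \<infinity> then 0
     else exp (- \<epsilon> * real_of_ereal (gromov_prod_bdry p \<xi> \<eta>)))"

definition bdry_map :: "('a \<Rightarrow> 'a) \<Rightarrow> 'a bpoint \<Rightarrow> 'a bpoint" where
  "bdry_map g \<xi> = (\<lambda>u. g \<circ> u) ` \<xi>"


section \<open>Hausdorff measure\<close>

text \<open>Both notions are used for a set \<open>M\<close> with a distance function \<open>d\<close>.\<close>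

definition set_diam :: "('b \<Rightarrow> 'b \<Rightarrow> real) \<Rightarrow> 'b set \<Rightarrow> real" where
  "set_diam d U = (if U = {} then 0 else SUP (x, y) \<in> U \<times> U. d x y)"

text \<open>The exponent \<open>D\<close> is meant to be positive, so that \<open>0 powr D = 0\<close> is the usual convention.
  The pointwise bound by \<open>\<delta>\<close> says \<open>diam (U i) \<le> \<delta>\<close> and makes the supremum in
  \<^const>\<open>set_diam\<close> a bounded one.\<close>

definition hausdorff_outer ::
  "'b set \<Rightarrow> ('b \<Rightarrow> 'b \<Rightarrow> real) \<Rightarrow> real \<Rightarrow> 'b set \<Rightarrow> ennreal" where
  "hausdorff_outer M d D A = (SUP \<delta>\<in>{0<..}.
     Inf {\<Sum>i. ennreal (set_diam d (U i) powr D) | U :: nat \<Rightarrow> 'b set.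
        A \<subseteq> (\<Union>i. U i) \<and> (\<forall>i. U i \<subseteq> M) \<and> (\<forall>i. \<forall>x\<in>U i. \<forall>y\<in>U i. d x y \<le> \<delta>)})"

definition hausdorff_measure :: "'b set \<Rightarrow> ('b \<Rightarrow> 'b \<Rightarrow> real) \<Rightarrow> real \<Rightarrow> 'b measure" where
  "hausdorff_measure M d D =
     measure_of M {U. openin (Metric_space.mtopology M d) U} (hausdorff_outer M d D)"


section \<open>Discrete groups of isometries\<close>

definition isometry_group :: "('a::metric_space \<Rightarrow> 'a) set \<Rightarrow> bool" where
  "isometry_group \<Gamma> \<longleftrightarrow> subgroup \<Gamma> (BijGroup UNIV) \<and>
     (\<forall>\<gamma>\<in>\<Gamma>. \<forall>x y. dist (\<gamma> x) (\<gamma> y) = dist x y)"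

definition properly_discontinuous :: "('a::metric_space \<Rightarrow> 'a) set \<Rightarrow> bool" where
  "properly_discontinuous \<Gamma> \<longleftrightarrow> (\<forall>K. compact K \<longrightarrow> finite {\<gamma>\<in>\<Gamma>. \<gamma> ` K \<inter> K \<noteq> {}})"

definition cocompact :: "('a::metric_space \<Rightarrow> 'a) set \<Rightarrow> bool" where
  "cocompact \<Gamma> \<longleftrightarrow> (\<exists>K. compact K \<and> (\<Union>\<gamma>\<in>\<Gamma>. \<gamma> ` K) = UNIV)"

definition limit_set :: "('a::metric_space \<Rightarrow> 'a) set \<Rightarrow> 'a \<Rightarrow> 'a bpoint set" where
  "limit_set \<Gamma> p = {\<xi> \<in> gromov_boundary p. \<exists>u\<in>\<xi>. \<forall>n. u n \<in> (\<lambda>\<gamma>. \<gamma> p) ` \<Gamma>}"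

text \<open>Non-elementary: the limit set has more than two points.\<close>

definition non_elementary :: "('a::metric_space \<Rightarrow> 'a) set \<Rightarrow> 'a \<Rightarrow> bool" where
  "non_elementary \<Gamma> p \<longleftrightarrow> \<not> (finite (limit_set \<Gamma> p) \<and> card (limit_set \<Gamma> p) \<le> 2)"

definition volume_growth :: "('a::metric_space \<Rightarrow> 'a) set \<Rightarrow> 'a \<Rightarrow> real" where
  "volume_growth \<Gamma> p = real_of_ereal (Limsup at_top (\<lambda>T::real.
     ereal (1 / T * ln (real (card ((\<lambda>\<gamma>. \<gamma> p) ` \<Gamma> \<inter> ball p T))))))"

definition annulus :: "('a::metric_space \<Rightarrow> 'a) set \<Rightarrow> 'a \<Rightarrow> nat \<Rightarrow> real \<Rightarrow> ('a \<Rightarrow> 'a) set" where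
  "annulus \<Gamma> p n R = {\<gamma>\<in>\<Gamma>. real n * R \<le> dist p (\<gamma> p) \<and> dist p (\<gamma> p) < (real n + 1) * R}"


section \<open>Patterson--Sullivan measure and boundary representations\<close>

definition patterson_sullivan ::
  "('a::metric_space \<Rightarrow> 'a) set \<Rightarrow> 'a \<Rightarrow> real \<Rightarrow> 'a bpoint measure" where
  "patterson_sullivan \<Gamma> p \<epsilon> =
     (let H = hausdorff_measure (gromov_boundary p) (visual_dist p \<epsilon>) (volume_growth \<Gamma> p / \<epsilon>)
      in scale_measure (1 / emeasure H (space H)) H)"

text \<open>Elements of \<open>L\<^sup>2\<close> are represented by square integrable functions, not identified when
  they agree almost everywhere.\<close>

definition L2 :: "'b measure \<Rightarrow> ('b \<Rightarrow> complex) set" where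
  "L2 M = {v \<in> borel_measurable M. integrable M (\<lambda>x. (cmod (v x))\<^sup>2)}"

definition L2_norm :: "'b measure \<Rightarrow> ('b \<Rightarrow> complex) \<Rightarrow> real" where
  "L2_norm M v = sqrt (\<integral>x. (cmod (v x))\<^sup>2 \<partial>M)"

text \<open>For a linear \<open>T\<close>, finiteness of the operator norm includes that \<open>T\<close> maps
  square integrable functions to square integrable functions, and null functions to null functions.
  The value is \<open>\<infinity>\<close> if there is no bound.\<close>

definition op_norm :: "'b measure \<Rightarrow> (('b \<Rightarrow> complex) \<Rightarrow> ('b \<Rightarrow> complex)) \<Rightarrow> ereal" where
  "op_norm M T = Inf {ereal K | K. 0 \<le> K \<and>
     (\<forall>v\<in>L2 M. T v \<in> L2 M \<and> L2_norm M (T v) \<le> K * L2_norm M v)}"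

definition bdry_rep :: "'a bpoint measure \<Rightarrow> real \<Rightarrow> ('a \<Rightarrow> 'a)
    \<Rightarrow> ('a bpoint \<Rightarrow> complex) \<Rightarrow> ('a bpoint \<Rightarrow> complex)" where
  "bdry_rep \<nu> s \<gamma> v \<xi> =
     complex_of_real (enn2real (RN_deriv \<nu> (distr \<nu> \<nu> (bdry_map \<gamma>)) \<xi>) powr s)
       * v (bdry_map (inv_into UNIV \<gamma>) \<xi>)"

definition bdry_rep_sum :: "'a bpoint measure \<Rightarrow> real \<Rightarrow> (('a \<Rightarrow> 'a) \<Rightarrow> complex)
    \<Rightarrow> ('a bpoint \<Rightarrow> complex) \<Rightarrow> ('a bpoint \<Rightarrow> complex)" where
  "bdry_rep_sum \<nu> s f v \<xi> = (\<Sum>\<gamma> | f \<gamma> \<noteq> 0. f \<gamma> * bdry_rep \<nu> s \<gamma> v \<xi>)"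

definition omega :: "real \<Rightarrow> real \<Rightarrow> real \<Rightarrow> real" where
  "omega \<alpha> \<sigma> t =
     (if \<sigma> = 0 then t else 2 * sinh (\<sigma> * \<alpha> * t) / (1 - exp (- 2 * \<sigma> * \<alpha>)))"


section \<open>The boundary is well defined in strongly hyperbolic spaces\<close>

lemma gromov_prod_commute: "gromov_prod p x y = gromov_prod p y x"
  by (simp add: gromov_prod_def dist_commute)

lemma filterlim_gromov_iff:
  assumes "\<epsilon> > 0"
  shows "filterlim (\<lambda>(m, n). gromov_prod p (u m) (v n)) at_top (sequentially \<times>\<^sub>F sequentially)
    \<longleftrightarrow> (\<forall>e>0. \<exists>N. \<forall>m\<ge>N. \<forall>n\<ge>N. exp (- \<epsilon> * gromov_prod p (u m) (v n)) < e)"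
    (is "?L \<longleftrightarrow> ?R")
proof
  assume L: ?L
  show ?R
  proof (intro allI impI)
    fix e :: real assume e: "e > 0"
    have "eventually (\<lambda>(m, n). - (ln e / \<epsilon>) < gromov_prod p (u m) (v n))
        (sequentially \<times>\<^sub>F sequentially)"
      using L by (simp add: filterlim_at_top_dense case_prod_unfold)
    then obtain N where N: "- (ln e / \<epsilon>) < gromov_prod p (u m) (v n)" if "m \<ge> N" "n \<ge> N" for m n
      by (auto simp: eventually_prod_sequentially)
    have "exp (- \<epsilon> * gromov_prod p (u m) (v n)) < e" if "m \<ge> N" "n \<ge> N" for m n
    proof -
      have "- \<epsilon> * gromov_prod p (u m) (v n) < ln e"
        using N[OF that] assms by (simp add: field_simps)
      then show ?thesis
        using e by (metis exp_less_mono exp_ln)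
    qed
    then show "\<exists>N. \<forall>m\<ge>N. \<forall>n\<ge>N. exp (- \<epsilon> * gromov_prod p (u m) (v n)) < e" by blast
  qed
next
  assume R: ?R
  show ?L
    unfolding filterlim_at_top_dense
  proof
    fix Z :: real
    obtain N where N: "exp (- \<epsilon> * gromov_prod p (u m) (v n)) < exp (- \<epsilon> * Z)"
      if "m \<ge> N" "n \<ge> N" for m n
      using R by (meson exp_gt_zero)
    then have "Z < gromov_prod p (u m) (v n)" if "m \<ge> N" "n \<ge> N" for m n
      using N[OF that] assms by simp
    then show "eventually (\<lambda>x. Z < (case x of (m, n) \<Rightarrow> gromov_prod p (u m) (v n)))
        (sequentially \<times>\<^sub>F sequentially)"
      by (auto simp: eventually_prod_sequentially)
  qed
qed

lemma equiv_gromov_rel: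
  fixes p :: "'a::metric_space"
  assumes eps: "\<epsilon> > 0" and hyp: "strongly_hyperbolic TYPE('a) \<epsilon>"
  shows "equiv (gromov_seqs p) (gromov_rel p)"
proof (rule equivI)
  note F = filterlim_gromov_iff[OF eps]
  show "gromov_rel p \<subseteq> gromov_seqs p \<times> gromov_seqs p"
    by (auto simp: gromov_rel_def)
  show "refl_on (gromov_seqs p) (gromov_rel p)"
    by (auto simp: refl_on_def gromov_rel_def gromov_seqs_def)
  show "sym (gromov_rel p)"
  proof (rule symI)
    fix u v assume "(u, v) \<in> gromov_rel p"
    then show "(v, u) \<in> gromov_rel p"
      by (simp only: gromov_rel_def F mem_Collect_eq prod.case)
        (subst gromov_prod_commute, blast)
  qed
  show "trans (gromov_rel p)"
  proof (rule transI)
    have FR: "\<exists>N. \<forall>m\<ge>N. \<forall>n\<ge>N. exp (- \<epsilon> * gromov_prod p (a m) (b n)) < e"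
      if "(a, b) \<in> gromov_rel p" "e > 0" for a b e
      using that by (simp only: gromov_rel_def F mem_Collect_eq prod.case)
    fix u v w assume uv: "(u, v) \<in> gromov_rel p" and vw: "(v, w) \<in> gromov_rel p"
    have "\<exists>N. \<forall>m\<ge>N. \<forall>n\<ge>N. exp (- \<epsilon> * gromov_prod p (u m) (w n)) < e" if "e > 0" for e
    proof -
      obtain N where N: "\<And>m n. m \<ge> N \<Longrightarrow> n \<ge> N \<Longrightarrow> exp (- \<epsilon> * gromov_prod p (u m) (v n)) < e/2"
        using FR[OF uv half_gt_zero[OF \<open>e > 0\<close>]] by blast
      obtain M where M: "\<And>m n. m \<ge> M \<Longrightarrow> n \<ge> M \<Longrightarrow> exp (- \<epsilon> * gromov_prod p (v m) (w n)) < e/2"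
        using FR[OF vw half_gt_zero[OF \<open>e > 0\<close>]] by blast
      have "exp (- \<epsilon> * gromov_prod p (u m) (w n)) < e" if "m \<ge> max M N" "n \<ge> max M N" for m n
      proof -
        have "exp (- \<epsilon> * gromov_prod p (u m) (w n)) \<le> exp (- \<epsilon> * gromov_prod p (u m) (v (max M N)))
            + exp (- \<epsilon> * gromov_prod p (v (max M N)) (w n))"
          using hyp by (simp add: strongly_hyperbolic_def)
        also have "\<dots> < e/2 + e/2"
          using that by (intro add_strict_mono N M) auto
        finally show ?thesis by simp
      qed
      then show ?thesis by blast
    qed
    then show "(u, w) \<in> gromov_rel p"
      using uv vw by (simp add: gromov_rel_def F)
  qed
qed

lemma gromov_prod_bdry_tendsto:
  fixes p :: "'a::metric_space"
  assumes eps: "\<epsilon> > 0" and hyp: "strongly_hyperbolic TYPE('a) \<epsilon>"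
    and bd: "\<xi> \<in> gromov_boundary p" "\<eta> \<in> gromov_boundary p" and uv: "u \<in> \<xi>" "v \<in> \<eta>"
  shows "((\<lambda>(m, n). ereal (gromov_prod p (u m) (v n))) \<longlongrightarrow> gromov_prod_bdry p \<xi> \<eta>)
    (sequentially \<times>\<^sub>F sequentially)"
proof -
  let ?F = "sequentially \<times>\<^sub>F sequentially"
  define E where "E x y = exp (- \<epsilon> * gromov_prod p x y)" for x y
  have Epos: "E x y > 0" for x y by (simp add: E_def)
  have Esym: "E x y = E y x" for x y by (simp add: E_def gromov_prod_commute)
  have Etri: "E x y \<le> E x z + E z y" for x y z
    using hyp by (simp add: strongly_hyperbolic_def E_def)
  have Ediff: "\<bar>E x y - E x' y'\<bar> \<le> E x x' + E y y'" for x y x' y'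
    using Etri[of x y x'] Etri[of x' y y'] Etri[of x' y' x] Etri[of x y' y]
    by (simp add: Esym[of x' x] Esym[of y' y] abs_le_iff)
  note F = filterlim_gromov_iff[OF eps, where p = p, folded E_def]
  note EQ = equiv_gromov_rel[OF eps hyp, of p]
  have rel: "(a, a') \<in> gromov_rel p" if "\<zeta> \<in> gromov_boundary p" "a \<in> \<zeta>" "a' \<in> \<zeta>" for \<zeta> a a'
    using that by (intro in_quotient_imp_in_rel[OF EQ]) (auto simp: gromov_boundary_def)
  have relE: "\<exists>N. \<forall>m\<ge>N. \<forall>n\<ge>N. E (a m) (a' n) < e"
    if "\<zeta> \<in> gromov_boundary p" "a \<in> \<zeta>" "a' \<in> \<zeta>" "e > 0" for \<zeta> a a' e
    using rel[OF that(1-3)] that(4) by (simp only: gromov_rel_def F mem_Collect_eq prod.case)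
  have close: "\<exists>N. \<forall>m\<ge>N. \<forall>n\<ge>N. \<forall>k\<ge>N. \<forall>l\<ge>N. \<bar>E (a m) (b n) - E (a' k) (b' l)\<bar> < e"
    if ab: "a \<in> \<xi>" "a' \<in> \<xi>" "b \<in> \<eta>" "b' \<in> \<eta>" and e: "e > 0" for a a' b b' e
  proof -
    obtain N where N: "\<And>m n. m \<ge> N \<Longrightarrow> n \<ge> N \<Longrightarrow> E (a m) (a' n) < e/2"
      using relE[OF bd(1) ab(1,2) half_gt_zero[OF e]] by blast
    obtain M where M: "\<And>m n. m \<ge> M \<Longrightarrow> n \<ge> M \<Longrightarrow> E (b m) (b' n) < e/2"
      using relE[OF bd(2) ab(3,4) half_gt_zero[OF e]] by blast
    have "\<bar>E (a m) (b n) - E (a' k) (b' l)\<bar> < e"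
      if "m \<ge> max M N" "n \<ge> max M N" "k \<ge> max M N" "l \<ge> max M N" for m n k l
    proof -
      have "E (a m) (a' k) < e/2" "E (b n) (b' l) < e/2"
        using that N[of m k] M[of n l] by simp_all
      then show ?thesis
        using Ediff[of "a m" "b n" "a' k" "b' l"] by linarith
    qed
    then show ?thesis by blast
  qed
  have "Cauchy (\<lambda>n. E (u n) (v n))"
  proof (rule CauchyI)
    fix e :: real assume e: "e > 0"
    obtain N where "\<forall>m\<ge>N. \<forall>n\<ge>N. \<forall>k\<ge>N. \<forall>l\<ge>N. \<bar>E (u m) (v n) - E (u k) (v l)\<bar> < e"
      using close[OF uv(1) uv(1) uv(2) uv(2) e] ..
    then show "\<exists>N. \<forall>m\<ge>N. \<forall>n\<ge>N. norm (E (u m) (v m) - E (u n) (v n)) < e"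
      by (intro exI[of _ N]) simp
  qed
  then obtain L where L: "(\<lambda>n. E (u n) (v n)) \<longlonglongrightarrow> L"
    using Cauchy_convergent convergentD by blast
  have Elim: "((\<lambda>(m, n). E (a m) (b n)) \<longlongrightarrow> L) ?F" if ab: "a \<in> \<xi>" "b \<in> \<eta>" for a b
  proof (rule tendstoI)
    fix e :: real assume e: "e > 0"
    obtain N where N: "\<And>m n k. m \<ge> N \<Longrightarrow> n \<ge> N \<Longrightarrow> k \<ge> N \<Longrightarrow> \<bar>E (a m) (b n) - E (u k) (v k)\<bar> < e/2"
      using close[OF ab(1) uv(1) ab(2) uv(2) half_gt_zero[OF e]] by blast
    obtain M where M: "\<And>k. k \<ge> M \<Longrightarrow> \<bar>E (u k) (v k) - L\<bar> < e/2"
      using LIMSEQ_D[OF L half_gt_zero[OF e]] by auto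
    have "\<bar>E (a m) (b n) - L\<bar> < e" if "m \<ge> N" "n \<ge> N" for m n
      using N[OF that, of "max M N"] M[of "max M N"] by linarith
    then show "eventually (\<lambda>x. dist (case x of (m, n) \<Rightarrow> E (a m) (b n)) L < e) ?F"
      by (auto simp: eventually_prod_sequentially dist_real_def)
  qed
  have L0: "L \<ge> 0"
    by (rule LIMSEQ_le_const[OF L]) (auto intro: less_imp_le[OF Epos])
  define l where "l = (if L = 0 then \<infinity> else ereal (- ln L / \<epsilon>))"
  have gE: "gromov_prod p x y = - ln (E x y) / \<epsilon>" for x y
    using eps by (simp add: E_def)
  have lim: "((\<lambda>(m, n). ereal (gromov_prod p (a m) (b n))) \<longlongrightarrow> l) ?F"
    if ab: "a \<in> \<xi>" "b \<in> \<eta>" for a b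
  proof (cases "L = 0")
    case True
    have "\<exists>N. \<forall>m\<ge>N. \<forall>n\<ge>N. E (a m) (b n) < e" if "e > 0" for e
    proof -
      have "eventually (\<lambda>x. (case x of (m, n) \<Rightarrow> E (a m) (b n)) < e) ?F"
        using order_tendstoD(2)[OF Elim[OF ab]] True that by simp
      then show ?thesis by (auto simp: eventually_prod_sequentially)
    qed
    then have "filterlim (\<lambda>(m, n). gromov_prod p (a m) (b n)) at_top ?F"
      unfolding F by blast
    then show ?thesis
      using True by (simp add: l_def case_prod_unfold tendsto_PInfty filterlim_at_top_dense)
  next
    case False
    then have "((\<lambda>x. - ln (case x of (m, n) \<Rightarrow> E (a m) (b n)) / \<epsilon>) \<longlongrightarrow> - ln L / \<epsilon>) ?F"
      using eps by (intro tendsto_intros Elim[OF ab]) auto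
    then show ?thesis
      using False by (simp add: l_def case_prod_unfold gE)
  qed
  have "gromov_prod_bdry p \<xi> \<eta> = l"
    unfolding gromov_prod_bdry_def
  proof (rule the_equality)
    show "\<forall>u\<in>\<xi>. \<forall>v\<in>\<eta>. ((\<lambda>(m, n). ereal (gromov_prod p (u m) (v n))) \<longlongrightarrow> l) ?F"
      using lim by blast
  next
    fix l' assume "\<forall>u\<in>\<xi>. \<forall>v\<in>\<eta>. ((\<lambda>(m, n). ereal (gromov_prod p (u m) (v n))) \<longlongrightarrow> l') ?F"
    then show "l' = l"
      using lim[OF uv] uv by (intro tendsto_unique[of ?F]) (auto simp: prod_filter_eq_bot)
  qed
  then show ?thesis using lim[OF uv] by simp
qed

end

theory Submission
  imports Defs
begin

text \<open>
  Write \<open>(\<cdot>,\<cdot>)\<close> for the Gromov product at the base point and \<open>|\<gamma>|\<close> for the displacement of the base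
  point, and cut the boundary into the levels \<open>A\<^sub>k(\<gamma>) = {\<xi>. k \<le> (\<xi>, \<gamma>p) < k + 1}\<close>. The identity
  \<open>(\<gamma>\<inverse>\<xi>, \<gamma>\<inverse>\<eta>) = (\<xi>, \<eta>) + |\<gamma>| - (\<xi>, \<gamma>p) - (\<eta>, \<gamma>p)\<close> shows that \<open>\<gamma>\<inverse>\<close> scales the visual
  distance on \<open>A\<^sub>k(\<gamma>)\<close> by \<open>exp (\<epsilon>(2k - |\<gamma>|))\<close>, up to a bounded factor, so the Radon--Nikodym derivative of
  \<open>\<gamma>\<^sub>*\<nu>\<close> is comparable there to \<open>exp (\<alpha>(2k - |\<gamma>|))\<close>. Only this crude comparison is used.

  For \<open>f\<close> supported on \<open>n \<le> |\<gamma>| < n + 1\<close>, the part of \<open>\<pi>\<^sub>s(f)\<close> coming from level \<open>k\<close> has norm at most a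
  constant times \<open>exp ((s - 1/2)\<alpha>(2k - n)) \<parallel>f\<parallel>\<^sub>2\<close>. This follows from the Cauchy--Schwarz inequality and a
  counting argument: if \<open>\<gamma>p\<close> and \<open>\<gamma>'p\<close> are close to \<open>\<xi>\<close> up to distance \<open>k\<close>, then \<open>\<gamma>\<close> is determined by
  \<open>\<gamma>'\<close> and \<open>\<gamma>\<inverse>\<xi>\<close> up to boundedly many choices. Summing the geometric series over \<open>k \<le> n\<close> produces
  \<open>1 + \<omega>\<close>.
\<close>

section \<open>Hausdorff outer measures\<close>

text \<open>Cutting a cover of \<open>B\<close> at scale \<open>\<delta> / L\<close> to the sets
  \<open>U i \<inter> B\<close> and mapping these by \<open>\<phi>\<close> gives a cover of the
  image at scale \<open>\<delta>\<close>, with diameters larger by at most the factor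
  \<open>L\<close>. Because of the cutting, \<open>\<phi>\<close> has to be Lipschitz on
  \<open>B\<close> only; later \<open>B\<close> lies in a single level.\<close>

lemma hausdorff_outer_image_le:
  assumes d: "\<And>x y. 0 \<le> d x y" and D: "D \<ge> 0" and L: "L > 0" and sub: "\<phi> ` B \<subseteq> M"
    and lip: "\<And>x y. x \<in> B \<Longrightarrow> y \<in> B \<Longrightarrow> d (\<phi> x) (\<phi> y) \<le> L * d x y"
  shows "hausdorff_outer M d D (\<phi> ` B) \<le> ennreal (L powr D) * hausdorff_outer M d D B"
proof -
  define H where "H \<delta> A = Inf {\<Sum>i. ennreal (set_diam d (U i) powr D) | U :: nat \<Rightarrow> 'a set.
        A \<subseteq> (\<Union>i. U i) \<and> (\<forall>i. U i \<subseteq> M) \<and> (\<forall>i. \<forall>x\<in>U i. \<forall>y\<in>U i. d x y \<le> \<delta>)}" for \<delta> A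
  let ?c = "ennreal (L powr D)"
  have c0: "?c \<noteq> 0" using L by simp
  have diam: "0 \<le> set_diam d U" "set_diam d (\<phi> ` (U \<inter> B)) \<le> L * set_diam d U"
    if U: "\<forall>x\<in>U. \<forall>y\<in>U. d x y \<le> \<delta>" for U \<delta>
  proof -
    have bdd: "bdd_above ((\<lambda>(x, y). d x y) ` (U \<times> U))"
      using U by (intro bdd_aboveI[of _ \<delta>]) auto
    have up: "d x y \<le> set_diam d U" if "x \<in> U" "y \<in> U" for x y
      using cSUP_upper[OF _ bdd, of "(x, y)"] that by (auto simp: set_diam_def)
    show nn: "0 \<le> set_diam d U"
    proof (cases "U = {}")
      case False
      then obtain x where "x \<in> U" by blast
      then show ?thesis using up[of x x] d[of x x] by linarith
    qed (simp add: set_diam_def)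
    show "set_diam d (\<phi> ` (U \<inter> B)) \<le> L * set_diam d U"
    proof (cases "U \<inter> B = {}")
      case False
      have "d (\<phi> x) (\<phi> y) \<le> L * set_diam d U" if "x \<in> U \<inter> B" "y \<in> U \<inter> B" for x y
        using lip[of x y] up[of x y] that L by (meson IntD1 IntD2 mult_left_mono less_imp_le order_trans)
      then have "(SUP (x, y)\<in>\<phi> ` (U \<inter> B) \<times> \<phi> ` (U \<inter> B). d x y) \<le> L * set_diam d U"
        using False by (intro cSUP_least) auto
      then show ?thesis using False by (auto simp: set_diam_def)
    qed (use nn L in \<open>simp add: set_diam_def\<close>)
  qed
  have "H \<delta> (\<phi> ` B) \<le> ?c * hausdorff_outer M d D B" if "\<delta> > 0" for \<delta>
  proof -
    have le: "H \<delta> (\<phi> ` B) \<le> ?c * (\<Sum>i. ennreal (set_diam d (U i) powr D))"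
      if U: "B \<subseteq> (\<Union>i. U i)" "\<forall>i. U i \<subseteq> M" "\<forall>i. \<forall>x\<in>U i. \<forall>y\<in>U i. d x y \<le> \<delta> / L" for U :: "nat \<Rightarrow> 'a set"
    proof -
      let ?V = "\<lambda>i. \<phi> ` (U i \<inter> B)"
      have *: "d (\<phi> x) (\<phi> y) \<le> \<delta>" if "x \<in> U i \<inter> B" "y \<in> U i \<inter> B" for i x y
      proof -
        have "d (\<phi> x) (\<phi> y) \<le> L * d x y" using that lip by blast
        also have "\<dots> \<le> L * (\<delta> / L)" using that U(3) L by (intro mult_left_mono) auto
        finally show ?thesis using L by simp
      qed
      have "H \<delta> (\<phi> ` B) \<le> (\<Sum>i. ennreal (set_diam d (?V i) powr D))"
      proof -
        have "\<phi> ` B \<subseteq> (\<Union>i. ?V i)" using U(1) by blast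
        moreover have "\<forall>i. ?V i \<subseteq> M" using sub by blast
        moreover have "\<forall>i. \<forall>x\<in>?V i. \<forall>y\<in>?V i. d x y \<le> \<delta>" using * by blast
        ultimately show ?thesis unfolding H_def by (intro Inf_lower CollectI exI[of _ ?V]) simp
      qed
      also have "\<dots> \<le> (\<Sum>i. ?c * ennreal (set_diam d (U i) powr D))"
      proof (intro suminf_le)
        fix i
        have "0 \<le> set_diam d (?V i)"
          by (rule diam(1)[of _ "\<delta>"]) (use * in blast)
        then have "set_diam d (?V i) powr D \<le> (L * set_diam d (U i)) powr D"
          using diam[of "U i" "\<delta> / L"] U(3) D by (intro powr_mono2) auto
        also have "\<dots> = L powr D * set_diam d (U i) powr D"
          by (rule powr_mult)
        finally show "ennreal (set_diam d (?V i) powr D) \<le> ?c * ennreal (set_diam d (U i) powr D)"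
          by (simp add: ennreal_mult[symmetric] ennreal_leI)
      qed auto
      finally show ?thesis by simp
    qed
    \<comment> \<open>The infimum over covers of \<open>B\<close> needs a lower bound that is the
      same for all covers. The factor \<open>?c\<close>, finite and nonzero, is therefore divided
      out first and restored afterwards.\<close>
    have "H \<delta> (\<phi> ` B) / ?c \<le> H (\<delta> / L) B"
      unfolding H_def[of _ B]
    proof (rule Inf_greatest, safe)
      fix U :: "nat \<Rightarrow> 'a set"
      assume "B \<subseteq> (\<Union>i. U i)" "\<forall>i. U i \<subseteq> M" "\<forall>i. \<forall>x\<in>U i. \<forall>y\<in>U i. d x y \<le> \<delta> / L"
      from le[OF this] c0 show "H \<delta> (\<phi> ` B) / ?c \<le> (\<Sum>i. ennreal (set_diam d (U i) powr D))"
        by (intro divide_le_posI_ennreal) (auto simp: mult.commute zero_less_iff_neq_zero)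
    qed
    also have "\<dots> \<le> hausdorff_outer M d D B"
      unfolding hausdorff_outer_def H_def using that L by (intro SUP_upper) auto
    finally have "?c * (H \<delta> (\<phi> ` B) / ?c) \<le> ?c * hausdorff_outer M d D B"
      by (rule mult_left_mono) simp
    then show ?thesis using c0 by (simp add: ennreal_times_divide ennreal_mult_divide_eq mult.commute[of ?c])
  qed
  then show ?thesis
    unfolding hausdorff_outer_def[of _ _ _ "\<phi> ` B"] H_def by (auto intro!: SUP_least)
qed

text \<open>Since \<open>0 powr 0 = 0\<close>, singletons do not contribute. If the value is finite, then covers by sets of
  diameter tending to zero have a bounded number of other members, so all but finitely many points lie
  in a countable set.\<close>

lemma (in Metric_space) hausdorff_outer_zero_exponent:
  "hausdorff_outer M d 0 M = 0 \<or> hausdorff_outer M d 0 M = \<infinity>"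
proof (rule ccontr)
  assume ne: "\<not> ?thesis"
  then obtain N :: nat where N: "hausdorff_outer M d 0 M < of_nat N"
    by (metis ennreal_Ex_less_of_nat infinity_ennreal_def less_top)
  let ?\<delta> = "\<lambda>j. 1 / real (Suc j)"
  have "\<exists>U :: nat \<Rightarrow> 'a set. M \<subseteq> (\<Union>i. U i) \<and> (\<forall>i. U i \<subseteq> M) \<and> (\<forall>i. \<forall>x\<in>U i. \<forall>y\<in>U i. d x y \<le> ?\<delta> j)
      \<and> (\<Sum>i. ennreal (set_diam d (U i) powr 0)) < of_nat N" for j
  proof -
    have "Inf {\<Sum>i. ennreal (set_diam d (U i) powr 0) | U :: nat \<Rightarrow> 'a set.
        M \<subseteq> (\<Union>i. U i) \<and> (\<forall>i. U i \<subseteq> M) \<and> (\<forall>i. \<forall>x\<in>U i. \<forall>y\<in>U i. d x y \<le> ?\<delta> j)} \<le> hausdorff_outer M d 0 M"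
      unfolding hausdorff_outer_def by (rule SUP_upper) simp
    also note N
    finally show ?thesis unfolding Inf_less_iff by auto
  qed
  then obtain U :: "nat \<Rightarrow> nat \<Rightarrow> 'a set" where cov: "\<And>j. M \<subseteq> (\<Union>i. U j i)" and UM: "\<And>j i. U j i \<subseteq> M"
    and small: "\<And>j i x y. x \<in> U j i \<Longrightarrow> y \<in> U j i \<Longrightarrow> d x y \<le> ?\<delta> j"
    and sum: "\<And>j. (\<Sum>i. ennreal (set_diam d (U j i) powr 0)) < of_nat N"
    by metis
  \<comment> \<open>\<open>x powr 0\<close> is 1 for \<open>x \<noteq> 0\<close> and 0 for
    \<open>x = 0\<close>, so the sums count the members of nonzero diameter.\<close>
  define I where "I j = {i. set_diam d (U j i) \<noteq> 0}" for j
  have card_le: "card J \<le> N" if "finite J" "J \<subseteq> I j" for J j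
  proof -
    have "of_nat (card J) = (\<Sum>i\<in>J. ennreal (set_diam d (U j i) powr 0))"
      using that by (subst sum.cong[OF refl, of _ _ "\<lambda>_. 1"]) (auto simp: I_def)
    also have "\<dots> \<le> (\<Sum>i. ennreal (set_diam d (U j i) powr 0))"
      using that by (intro sum_le_suminf) auto
    also note sum[of j]
    finally show ?thesis by simp
  qed
  have fin: "finite (I j)" for j
    using card_le[of _ j] infinite_arbitrarily_large[of "I j" "Suc N"] by (metis not_less_eq_eq order_refl)
  have single: "x = y" if "x \<in> U j i" "y \<in> U j i" "i \<notin> I j" for x y i j
  proof -
    have "bdd_above ((\<lambda>(x, y). d x y) ` (U j i \<times> U j i))"
      using small by (intro bdd_aboveI[of _ "?\<delta> j"]) auto
    from cSUP_upper[OF _ this, of "(x, y)"] have "d x y \<le> set_diam d (U j i)"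
      using that by (auto simp: set_diam_def)
    moreover have M: "x \<in> M" "y \<in> M" using that UM by blast+
    ultimately have "d x y \<le> 0" using that by (simp add: I_def)
    then have "d x y = 0" by (rule order.antisym) simp
    then show ?thesis using M by simp
  qed
  \<comment> \<open>The points that lie in a member of nonzero diameter at every scale. At a scale
    below their mutual distances, \<open>Suc N\<close> of them would lie in distinct such members,
    but there are at most \<open>N\<close>.\<close>
  define G where "G = (\<Inter>j. \<Union>i\<in>I j. U j i)"
  have "\<not> (infinite G \<or> card G > N)"
  proof
    assume "infinite G \<or> card G > N"
    then obtain F where F: "F \<subseteq> G" "finite F" "card F = Suc N"
      by (metis Suc_leI infinite_arbitrarily_large obtain_subset_with_card_n)
    have FM: "F \<subseteq> M" using F(1) UM unfolding G_def by blast
    define m where "m = Min ((\<lambda>(x, y). d x y) ` {(x, y) \<in> F \<times> F. x \<noteq> y} \<union> {1})"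
    have finF: "finite ((\<lambda>(x, y). d x y) ` {(x, y) \<in> F \<times> F. x \<noteq> y} \<union> {1})"
      using F(2) by (intro finite_UnI finite_imageI finite_subset[OF _ finite_cartesian_product[OF F(2) F(2)]]) auto
    have "d x y > 0" if "x \<in> F" "y \<in> F" "x \<noteq> y" for x y
      using that FM zero[of x y] nonneg[of x y] by (metis less_eq_real_def subsetD)
    then have "m > 0" unfolding m_def by (subst Min_gr_iff[OF finF]) auto
    then obtain j where j: "?\<delta> j < m" using nat_approx_posE by blast
    have "\<forall>x\<in>F. \<exists>i\<in>I j. x \<in> U j i" using F(1) unfolding G_def by blast
    then obtain f where f: "\<And>x. x \<in> F \<Longrightarrow> f x \<in> I j \<and> x \<in> U j (f x)" by metis
    have "inj_on f F"
    proof (rule inj_onI, rule ccontr)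
      fix x y assume xy: "x \<in> F" "y \<in> F" "f x = f y" "x \<noteq> y"
      have "m \<le> d x y" unfolding m_def using xy by (intro Min_le[OF finF]) auto
      moreover have "d x y \<le> ?\<delta> j" using f[OF xy(1)] f[OF xy(2)] xy(3) by (intro small) auto
      ultimately show False using j by simp
    qed
    moreover have "f ` F \<subseteq> I j" using f by blast
    ultimately have "card F \<le> N" using card_le[OF fin[of j] order_refl] card_inj_on_le[OF _ _ fin] le_trans by blast
    then show False using F(3) by simp
  qed
  then have "countable G" by (auto intro: countable_finite)
  moreover have "countable (\<Union>j. \<Union>i\<in>- I j. U j i)"
  proof (intro countable_UN)
    fix j i assume "i \<in> - I j"
    then have "U j i = {} \<or> (\<exists>x. U j i = {x})" using single[of _ j i] by blast
    then show "countable (U j i)" by (elim disjE exE) simp_all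
  qed (rule countableI_type)+
  moreover have "M \<subseteq> G \<union> (\<Union>j. \<Union>i\<in>- I j. U j i)"
  proof
    fix x assume "x \<in> M"
    then have "\<exists>i. x \<in> U j i" for j using cov[of j] by blast
    then show "x \<in> G \<union> (\<Union>j. \<Union>i\<in>- I j. U j i)" by (auto simp: G_def) (metis ComplI)
  qed
  ultimately have "countable M" using countable_subset[OF _ countable_Un] by blast
  have "hausdorff_outer M d 0 M \<le> 0"
    unfolding hausdorff_outer_def
  proof (intro SUP_least Inf_lower CollectI)
    fix \<delta> :: real assume "\<delta> \<in> {0<..}"
    let ?V = "\<lambda>i. if M = {} then {} else {from_nat_into M i}"
    have "set_diam d (?V i) = 0" for i
      using from_nat_into[of M] by (cases "M = {}") (auto simp: set_diam_def)
    then have "(\<Sum>i. ennreal (set_diam d (?V i) powr 0)) = 0" by simp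
    moreover have "M \<subseteq> (\<Union>i. ?V i)" using range_from_nat_into[OF _ \<open>countable M\<close>] by auto
    moreover have "\<forall>i. ?V i \<subseteq> M" using from_nat_into[of M] by auto
    moreover have "\<forall>i. \<forall>x\<in>?V i. \<forall>y\<in>?V i. d x y \<le> \<delta>"
      using from_nat_into[of M] \<open>\<delta> \<in> {0<..}\<close> by auto
    ultimately show "\<exists>U :: nat \<Rightarrow> 'a set. 0 = (\<Sum>i. ennreal (set_diam d (U i) powr 0)) \<and> M \<subseteq> (\<Union>i. U i) \<and>
      (\<forall>i. U i \<subseteq> M) \<and> (\<forall>i. \<forall>x\<in>U i. \<forall>y\<in>U i. d x y \<le> \<delta>)"
      by (intro exI[of _ ?V]) auto
  qed
  with ne show False by simp
qed

lemma (in Metric_space) sets_hausdorff_measure: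
  "sets (hausdorff_measure M d D) = sigma_sets M {U. openin mtopology U}"
  unfolding hausdorff_measure_def using openin_subset[of mtopology] by (intro sets_measure_of) auto

text \<open>\<open>measure_of\<close> keeps the given set function if it is a measure on the
  generated sigma-algebra, and otherwise returns the null measure. Carrying both alternatives along
  replaces a proof of countable additivity on the Borel sets.\<close>

lemma (in Metric_space) emeasure_hausdorff_measure_cases:
  "(\<forall>A \<in> sets (hausdorff_measure M d D). emeasure (hausdorff_measure M d D) A = hausdorff_outer M d D A) \<or>
   (\<forall>A. emeasure (hausdorff_measure M d D) A = 0)"
proof (cases "measure_space M (sigma_sets M {U. openin mtopology U}) (hausdorff_outer M d D)")
  case True
  then show ?thesis
    unfolding sets_hausdorff_measure unfolding hausdorff_measure_def by (auto simp: emeasure_measure_of_conv)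
next
  case False
  then show ?thesis unfolding hausdorff_measure_def by (auto simp: emeasure_measure_of_conv)
qed

section \<open>Square integrals and operator norms\<close>

text \<open>On the part of \<open>B\<close> where \<open>g\<close> exceeds \<open>c\<close>, the
  difference \<open>g - c\<close> is positive, while the hypothesis forces its integral to vanish.
  Finiteness of \<open>M\<close> and of \<open>c\<close> permits the subtraction of extended
  integrals.\<close>

lemma AE_le_of_density_le:
  assumes g: "g \<in> borel_measurable M" and B: "B \<in> sets M" and "finite_measure M" and c: "c < \<infinity>"
    and le: "\<And>A. A \<in> sets M \<Longrightarrow> A \<subseteq> B \<Longrightarrow> emeasure (density M g) A \<le> c * emeasure M A"
  shows "AE x in M. x \<in> B \<longrightarrow> g x \<le> c"
proof -
  interpret finite_measure M by fact
  define A where "A = {x \<in> space M. c < g x} \<inter> B"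
  have A: "A \<in> sets M" "A \<subseteq> B" using g B unfolding A_def by auto
  have fin: "(\<integral>\<^sup>+x. c * indicator A x \<partial>M) \<noteq> \<infinity>"
    using c A(1) by (simp add: nn_integral_cmult_indicator ennreal_mult_eq_top_iff)
  have "(\<integral>\<^sup>+x. g x * indicator A x - c * indicator A x \<partial>M) =
      (\<integral>\<^sup>+x. g x * indicator A x \<partial>M) - (\<integral>\<^sup>+x. c * indicator A x \<partial>M)"
  proof (rule nn_integral_diff)
    show "AE x in M. c * indicator A x \<le> g x * indicator A x" by (auto simp: A_def indicator_def)
  qed (use g A(1) fin in measurable)
  also have "\<dots> = 0"
    using le[OF A] A(1) g fin by (auto simp: emeasure_density nn_integral_cmult_indicator diff_eq_0_iff_ennreal less_top)
  finally have "AE x in M. g x * indicator A x - c * indicator A x = 0"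
    using g A(1) by (subst (asm) nn_integral_0_iff_AE) auto
  then show ?thesis
  proof (rule AE_mp, intro AE_I2 impI)
    fix x assume x: "x \<in> space M" "g x * indicator A x - c * indicator A x = 0" "x \<in> B"
    show "g x \<le> c"
    proof (rule ccontr)
      assume "\<not> g x \<le> c"
      with x have "x \<in> A" by (auto simp: A_def)
      with x(2) \<open>\<not> g x \<le> c\<close> c show False by (auto simp: ennreal_minus_eq_0)
    qed
  qed
qed

text \<open>The hypothesis is the case where \<open>g\<close> is an indicator. It compares two
  measures, the image under \<open>T\<close> of \<open>M\<close> restricted to \<open>A\<close> and
  a multiple of \<open>M\<close> on \<open>A'\<close>, and the integral is monotone in the
  measure.\<close>

lemma nn_integral_indicator_comp_le:
  assumes T: "T \<in> measurable M M" and A: "A \<in> sets M" and A': "A' \<in> sets M"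
    and g: "g \<in> borel_measurable M"
    and le: "\<And>B. B \<in> sets M \<Longrightarrow> emeasure M (A \<inter> T -` B) \<le> c * emeasure M (A' \<inter> B)"
  shows "(\<integral>\<^sup>+x. indicator A x * g (T x) \<partial>M) \<le> c * (\<integral>\<^sup>+x. indicator A' x * g x \<partial>M)"
proof -
  let ?N = "distr (density M (indicator A)) M T" and ?N' = "density M (\<lambda>x. c * indicator A' x)"
  have "?N \<le> ?N'"
    unfolding le_measure_iff
  proof (simp, rule le_funI)
    fix B
    show "emeasure ?N B \<le> emeasure ?N' B"
    proof (cases "B \<in> sets M")
      case True
      have AB: "A \<inter> T -` B = (T -` B \<inter> space M) \<inter> A"
        using sets.sets_into_space[OF A] by auto
      have "emeasure ?N B = emeasure M (A \<inter> T -` B)"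
        using True T A measurable_sets[OF T True]
        by (simp add: emeasure_distr emeasure_restricted AB Int_commute)
      also have "\<dots> \<le> c * emeasure M (A' \<inter> B)" by (rule le[OF True])
      also have "\<dots> = emeasure ?N' B"
        using True A' by (simp add: emeasure_density nn_integral_cmult mult.assoc indicator_inter_arith[symmetric])
      finally show ?thesis .
    qed (simp add: emeasure_notin_sets)
  qed
  then have "integral\<^sup>N ?N g \<le> integral\<^sup>N ?N' g" by (intro nn_integral_mono_measure) auto
  then show ?thesis
    using T A A' g by (simp add: nn_integral_distr nn_integral_density nn_integral_cmult mult.assoc)
qed

text \<open>A Schur-type bound. Cauchy--Schwarz is applied pointwise to the sum over
  \<open>S\<close>, the terms with \<open>T j\<close> are moved to \<open>A' j\<close> by the change
  of variables, and for fixed \<open>i\<close> at most \<open>N\<close> indices \<open>j\<close>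
  survive at each point.\<close>

lemma nn_integral_sum_square_le:
  fixes f :: "'i \<Rightarrow> real" and u :: "'b \<Rightarrow> real" and T :: "'i \<Rightarrow> 'b \<Rightarrow> 'b" and N :: nat
  assumes S: "finite S" and T: "\<And>i. i \<in> S \<Longrightarrow> T i \<in> measurable M M"
    and A: "\<And>i. i \<in> S \<Longrightarrow> A i \<in> sets M" and A': "\<And>i. i \<in> S \<Longrightarrow> A' i \<in> sets M"
    and u: "u \<in> borel_measurable M"
    and change: "\<And>i g. i \<in> S \<Longrightarrow> g \<in> borel_measurable M \<Longrightarrow>
      (\<integral>\<^sup>+x. indicator (A i) x * g (T i x) \<partial>M) \<le> c * (\<integral>\<^sup>+x. indicator (A' i) x * g x \<partial>M)"
    and rel: "\<And>i j x. i \<in> S \<Longrightarrow> j \<in> S \<Longrightarrow> x \<in> A i \<Longrightarrow> x \<in> A j \<Longrightarrow> P j i"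
    and count: "\<And>i y. i \<in> S \<Longrightarrow> y \<in> space M \<Longrightarrow> card {j \<in> S. P j i \<and> y \<in> A' j} \<le> N"
  shows "(\<integral>\<^sup>+x. ennreal ((\<Sum>i\<in>S. f i * (indicator (A i) x * u (T i x)))\<^sup>2) \<partial>M)
    \<le> c * of_nat N * ennreal (\<Sum>i\<in>S. (f i)\<^sup>2) * (\<integral>\<^sup>+x. ennreal ((u x)\<^sup>2) \<partial>M)"
proof -
  note [measurable] = T A A' u
  let ?q = "\<lambda>j i. if P j i then 1 else 0 :: ennreal"
  let ?F = "\<lambda>j x. indicator (A j) x * ennreal ((u (T j x))\<^sup>2)"
  have pt: "ennreal ((\<Sum>i\<in>S. f i * (indicator (A i) x * u (T i x)))\<^sup>2)
      \<le> (\<Sum>i\<in>S. \<Sum>j\<in>S. ennreal ((f i)\<^sup>2) * (?q j i * ?F j x))" for x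
  proof -
    \<comment> \<open>The indicator is idempotent, so each factor of Cauchy--Schwarz can receive a
      copy.\<close>
    have "(\<Sum>i\<in>S. f i * (indicator (A i) x * u (T i x)))\<^sup>2 =
        (\<Sum>i\<in>S. (f i * indicator (A i) x) * (indicator (A i) x * u (T i x)))\<^sup>2"
      by (intro arg_cong[where f = "\<lambda>z. z\<^sup>2"] sum.cong) (auto simp: indicator_def)
    also have "\<dots> \<le> (\<Sum>i\<in>S. (f i * indicator (A i) x)\<^sup>2) * (\<Sum>j\<in>S. (indicator (A j) x * u (T j x))\<^sup>2)"
      by (rule Cauchy_Schwarz_ineq_sum)
    also have "\<dots> = (\<Sum>i\<in>S. \<Sum>j\<in>S. (f i)\<^sup>2 * (indicator (A i) x * (indicator (A j) x * (u (T j x))\<^sup>2)))"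
      by (auto simp: sum_product indicator_def intro!: sum.cong)
    also have "ennreal \<dots> = (\<Sum>i\<in>S. \<Sum>j\<in>S. ennreal ((f i)\<^sup>2) * (indicator (A i) x * ?F j x))"
      by (simp add: sum_ennreal[symmetric] sum_nonneg ennreal_mult ennreal_indicator[symmetric] del: sum_ennreal)
    \<comment> \<open>\<open>P j i\<close> does not depend on \<open>x\<close>. Unlike the indicator
      of \<open>A i\<close>, it leaves the integral before the change of variables by
      \<open>T j\<close>.\<close>
    also have "\<dots> \<le> (\<Sum>i\<in>S. \<Sum>j\<in>S. ennreal ((f i)\<^sup>2) * (?q j i * ?F j x))"
      using rel by (intro sum_mono mult_left_mono) (auto simp: indicator_def)
    finally show ?thesis by (simp add: ennreal_leI)
  qed
  have "(\<integral>\<^sup>+x. ennreal ((\<Sum>i\<in>S. f i * (indicator (A i) x * u (T i x)))\<^sup>2) \<partial>M)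
      \<le> (\<integral>\<^sup>+x. (\<Sum>i\<in>S. \<Sum>j\<in>S. ennreal ((f i)\<^sup>2) * (?q j i * ?F j x)) \<partial>M)"
    by (intro nn_integral_mono pt)
  also have "\<dots> = (\<Sum>i\<in>S. \<Sum>j\<in>S. ennreal ((f i)\<^sup>2) * (?q j i * (\<integral>\<^sup>+x. ?F j x \<partial>M)))"
    by (simp add: nn_integral_sum nn_integral_cmult)
  also have "\<dots> \<le> (\<Sum>i\<in>S. \<Sum>j\<in>S. ennreal ((f i)\<^sup>2) * (?q j i * (c * (\<integral>\<^sup>+x. indicator (A' j) x * ennreal ((u x)\<^sup>2) \<partial>M))))"
    by (intro sum_mono mult_left_mono change) auto
  also have "\<dots> = (\<integral>\<^sup>+x. (\<Sum>i\<in>S. ennreal ((f i)\<^sup>2) * (c * ennreal ((u x)\<^sup>2) * (\<Sum>j\<in>S. ?q j i * indicator (A' j) x))) \<partial>M)"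
  proof -
    have "(\<Sum>i\<in>S. ennreal ((f i)\<^sup>2) * (c * ennreal ((u x)\<^sup>2) * (\<Sum>j\<in>S. ?q j i * indicator (A' j) x))) =
       (\<Sum>i\<in>S. \<Sum>j\<in>S. (ennreal ((f i)\<^sup>2) * (?q j i * c)) * (indicator (A' j) x * ennreal ((u x)\<^sup>2)))" for x
      by (simp add: sum_distrib_left mult_ac)
    then show ?thesis by (simp add: nn_integral_sum nn_integral_cmult mult.assoc)
  qed
  also have "\<dots> \<le> (\<integral>\<^sup>+x. (\<Sum>i\<in>S. ennreal ((f i)\<^sup>2) * (c * ennreal ((u x)\<^sup>2) * of_nat N)) \<partial>M)"
  proof (intro nn_integral_mono sum_mono mult_left_mono)
    fix x i assume xi: "x \<in> space M" "i \<in> S"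
    have "(\<Sum>j\<in>S. ?q j i * indicator (A' j) x :: ennreal) = (\<Sum>j\<in>S. if P j i \<and> x \<in> A' j then 1 else 0)"
      by (intro sum.cong) auto
    also have "\<dots> = of_nat (card {j \<in> S. P j i \<and> x \<in> A' j})"
      using S by (simp add: sum.inter_filter[symmetric])
    also have "\<dots> \<le> of_nat N" using count[OF xi(2,1)] by simp
    finally show "(\<Sum>j\<in>S. ?q j i * indicator (A' j) x :: ennreal) \<le> of_nat N" .
  qed auto
  also have "\<dots> = c * of_nat N * ennreal (\<Sum>i\<in>S. (f i)\<^sup>2) * (\<integral>\<^sup>+x. ennreal ((u x)\<^sup>2) \<partial>M)"
  proof -
    have "(\<Sum>i\<in>S. ennreal ((f i)\<^sup>2) * (c * ennreal ((u x)\<^sup>2) * of_nat N)) =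
        (c * of_nat N * ennreal (\<Sum>i\<in>S. (f i)\<^sup>2)) * ennreal ((u x)\<^sup>2)" for x
      by (simp only: sum_distrib_right[symmetric] sum_ennreal zero_le_power2) (simp add: mult_ac)
    then show ?thesis by (simp add: nn_integral_cmult)
  qed
  finally show ?thesis .
qed

text \<open>The squared triangle inequality of the L2 norm for functions with a common norm bound.
  It follows from Cauchy--Schwarz with \<open>sqrt (w k)\<close> in both factors.\<close>

lemma nn_integral_weighted_sum_square_le:
  fixes w :: "'k \<Rightarrow> real" and G :: "'k \<Rightarrow> 'b \<Rightarrow> real"
  assumes w: "\<And>k. k \<in> K \<Longrightarrow> w k \<ge> 0" and G[measurable]: "\<And>k. k \<in> K \<Longrightarrow> G k \<in> borel_measurable M"
    and le: "\<And>k. k \<in> K \<Longrightarrow> (\<integral>\<^sup>+x. ennreal ((G k x)\<^sup>2) \<partial>M) \<le> b"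
  shows "(\<integral>\<^sup>+x. ennreal ((\<Sum>k\<in>K. w k * G k x)\<^sup>2) \<partial>M) \<le> ennreal ((\<Sum>k\<in>K. w k)\<^sup>2) * b"
proof -
  have W: "0 \<le> (\<Sum>k\<in>K. w k)" using w by (rule sum_nonneg)
  have "(\<Sum>k\<in>K. w k * G k x)\<^sup>2 \<le> (\<Sum>k\<in>K. w k) * (\<Sum>k\<in>K. w k * (G k x)\<^sup>2)" for x
  proof -
    have "(\<Sum>k\<in>K. w k * G k x)\<^sup>2 = (\<Sum>k\<in>K. sqrt (w k) * (sqrt (w k) * G k x))\<^sup>2"
      using w by (intro arg_cong[where f = "\<lambda>z. z\<^sup>2"] sum.cong) (auto simp: mult.assoc[symmetric])
    also have "\<dots> \<le> (\<Sum>k\<in>K. (sqrt (w k))\<^sup>2) * (\<Sum>k\<in>K. (sqrt (w k) * G k x)\<^sup>2)"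
      by (rule Cauchy_Schwarz_ineq_sum)
    also have "\<dots> = (\<Sum>k\<in>K. w k) * (\<Sum>k\<in>K. w k * (G k x)\<^sup>2)"
      using w by (simp add: power_mult_distrib)
    finally show ?thesis .
  qed
  then have "(\<integral>\<^sup>+x. ennreal ((\<Sum>k\<in>K. w k * G k x)\<^sup>2) \<partial>M) \<le>
     (\<integral>\<^sup>+x. ennreal (\<Sum>k\<in>K. w k) * (\<Sum>k\<in>K. ennreal (w k) * ennreal ((G k x)\<^sup>2)) \<partial>M)"
    using w W by (intro nn_integral_mono)
      (simp add: ennreal_mult[symmetric] sum_nonneg ennreal_leI)
  also have "\<dots> = ennreal (\<Sum>k\<in>K. w k) * (\<Sum>k\<in>K. ennreal (w k) * (\<integral>\<^sup>+x. ennreal ((G k x)\<^sup>2) \<partial>M))"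
    by (simp add: nn_integral_cmult nn_integral_sum)
  also have "\<dots> \<le> ennreal (\<Sum>k\<in>K. w k) * (\<Sum>k\<in>K. ennreal (w k) * b)"
    using le by (intro mult_left_mono sum_mono) auto
  also have "\<dots> = ennreal ((\<Sum>k\<in>K. w k)\<^sup>2) * b"
    using w W by (simp add: sum_distrib_right[symmetric] power2_eq_square ennreal_mult mult.assoc)
  finally show ?thesis .
qed

lemma op_norm_le:
  assumes "K \<ge> 0" "\<And>v. v \<in> L2 M \<Longrightarrow> T v \<in> L2 M \<and> L2_norm M (T v) \<le> K * L2_norm M v"
  shows "op_norm M T \<le> ereal K"
  unfolding op_norm_def using assms by (intro Inf_lower) blast

lemma L2_of_null_measure:
  assumes "emeasure M (space M) = 0" "v \<in> borel_measurable M"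
  shows "v \<in> L2 M" "L2_norm M v = 0"
proof -
  have AE: "AE x in M. (cmod (v x))\<^sup>2 = 0" using assms(1) by (rule emeasure_0_AE)
  have "integrable M (\<lambda>x. (cmod (v x))\<^sup>2)"
    using assms(2) AE by (subst integrable_cong_AE[of _ _ "\<lambda>_. 0"]) auto
  then show "v \<in> L2 M" using assms(2) by (simp add: L2_def)
  show "L2_norm M v = 0" using AE by (simp add: L2_norm_def integral_eq_zero_AE)
qed

section \<open>Volume growth and the weight function\<close>

text \<open>The default values 0 for the cardinality of an infinite set, for \<open>ln 0\<close> and
  for \<open>real_of_ereal \<infinity>\<close> make this hold for every
  \<open>\<Gamma>\<close>.\<close>

lemma volume_growth_nonneg: "volume_growth \<Gamma> p \<ge> 0"
proof -
  have "0 \<le> Limsup at_top (\<lambda>T::real. ereal (1 / T * ln (real (card ((\<lambda>\<gamma>. \<gamma> p) ` \<Gamma> \<inter> ball p T)))))"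
  proof (rule le_Limsup)
    have "0 \<le> ln (real m)" for m :: nat by (cases m) auto
    then show "\<forall>\<^sub>F T::real in at_top. 0 \<le> ereal (1 / T * ln (real (card ((\<lambda>\<gamma>. \<gamma> p) ` \<Gamma> \<inter> ball p T))))"
      by (intro eventually_mono[OF eventually_gt_at_top[of 0]]) simp
  qed simp
  then show ?thesis unfolding volume_growth_def by (rule real_of_ereal_pos)
qed

lemma omega_nonneg: "\<alpha> \<ge> 0 \<Longrightarrow> \<sigma> \<ge> 0 \<Longrightarrow> t \<ge> 0 \<Longrightarrow> omega \<alpha> \<sigma> t \<ge> 0"
  by (auto simp: omega_def intro!: divide_nonneg_nonneg)

text \<open>A geometric series of ratio \<open>exp (- 2 * \<bar>\<sigma>\<bar> * \<alpha>)\<close>.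
  Ordered by decreasing size, its first \<open>n\<close> terms add up exactly to
  \<open>omega\<close>, and the last one is at most 1.\<close>

lemma sum_weights_le:
  fixes \<alpha> \<sigma> :: real
  assumes "\<alpha> > 0"
  shows "(\<Sum>k\<le>n. exp (\<sigma> * \<alpha> * (2 * real k - real n))) \<le> 1 + omega \<alpha> \<bar>\<sigma>\<bar> (real n)"
proof -
  have nonneg: "(\<Sum>k\<le>n. exp (\<tau> * \<alpha> * (real n - 2 * real k))) \<le> 1 + omega \<alpha> \<tau> (real n)" if "\<tau> \<ge> 0" for \<tau>
  proof (cases "\<tau> = 0")
    case False
    with that have t: "\<tau> > 0" by simp
    define q where "q = exp (- 2 * \<tau> * \<alpha>)"
    have q: "q < 1" using t assms by (simp add: q_def)
    have "(\<Sum>k<n. exp (\<tau> * \<alpha> * (real n - 2 * real k))) = exp (\<tau> * \<alpha> * n) * (\<Sum>k<n. q ^ k)"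
      by (simp add: sum_distrib_left q_def exp_of_nat_mult[symmetric] exp_add[symmetric] algebra_simps)
    also have "\<dots> = exp (\<tau> * \<alpha> * n) * (1 - q ^ n) / (1 - q)"
      using q by (simp add: sum_gp_strict)
    also have "exp (\<tau> * \<alpha> * n) * (1 - q ^ n) = 2 * sinh (\<tau> * \<alpha> * n)"
      by (simp add: sinh_def q_def exp_of_nat_mult[symmetric] right_diff_distrib exp_add[symmetric] algebra_simps)
    finally have "(\<Sum>k<n. exp (\<tau> * \<alpha> * (real n - 2 * real k))) = omega \<alpha> \<tau> n"
      using False by (simp add: omega_def q_def)
    moreover have "exp (\<tau> * \<alpha> * (real n - 2 * real n)) \<le> 1" using t assms by simp
    ultimately show ?thesis by (simp add: lessThan_Suc_atMost[symmetric] del: exp_le_one_iff)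
  qed (simp add: omega_def)
  show ?thesis
  proof (cases "\<sigma> \<ge> 0")
    case True
    \<comment> \<open>Reversing the order of summation changes the sign of the exponents.\<close>
    have "(\<Sum>k\<le>n. exp (\<sigma> * \<alpha> * (2 * real k - real n))) = (\<Sum>k\<le>n. exp (\<sigma> * \<alpha> * (2 * real (n - k) - real n)))"
      using sum.atLeastAtMost_rev[of "\<lambda>k. exp (\<sigma> * \<alpha> * (2 * real k - real n))" 0 n] by (simp add: atMost_atLeast0)
    also have "\<dots> = (\<Sum>k\<le>n. exp (\<sigma> * \<alpha> * (real n - 2 * real k)))"
      by (intro sum.cong) (auto simp: of_nat_diff algebra_simps)
    finally show ?thesis using nonneg[OF True] True by simp
  next
    case False
    have "(\<Sum>k\<le>n. exp (\<sigma> * \<alpha> * (2 * real k - real n))) = (\<Sum>k\<le>n. exp (\<bar>\<sigma>\<bar> * \<alpha> * (real n - 2 * real k)))"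
      using False by (intro sum.cong) (auto simp: algebra_simps)
    then show ?thesis using nonneg[of "\<bar>\<sigma>\<bar>"] by simp
  qed
qed

section \<open>The visual metric and its distortion under isometries\<close>

lemma gromov_prod_bdry_commute: "gromov_prod_bdry p \<xi> \<eta> = gromov_prod_bdry p \<eta> \<xi>"
proof -
  have swap: "((\<lambda>(m, n). ereal (gromov_prod p (v m) (u n))) \<longlongrightarrow> l) (sequentially \<times>\<^sub>F sequentially)"
    if "((\<lambda>(m, n). ereal (gromov_prod p (u m) (v n))) \<longlongrightarrow> l) (sequentially \<times>\<^sub>F sequentially)"
    for u v :: "nat \<Rightarrow> 'a" and l
  proof -
    have "filterlim (\<lambda>(m, n). (n, m)) (sequentially \<times>\<^sub>F sequentially) (sequentially \<times>\<^sub>F sequentially)"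
      by (auto simp: filterlim_iff eventually_prod_sequentially)
    from filterlim_compose[OF that this] show ?thesis
      by (simp add: case_prod_unfold gromov_prod_commute)
  qed
  show ?thesis
    unfolding gromov_prod_bdry_def by (rule arg_cong[where f = The]) (use swap in blast)
qed

locale strongly_hyperbolic_action =
  fixes p :: "'a::metric_space" and \<Gamma> :: "('a \<Rightarrow> 'a) set" and \<epsilon> :: real
  assumes eps: "\<epsilon> > 0"
    and hyp: "strongly_hyperbolic TYPE('a) \<epsilon>"
    and isom: "isometry_group \<Gamma>"
begin

section \<open>The exponentiated Gromov product and its limits at the boundary\<close>

abbreviation "bdry \<equiv> gromov_boundary p"
abbreviation "vd \<equiv> visual_dist p \<epsilon>"

text \<open>Strong hyperbolicity is the triangle inequality for this function. It is positive even
  on the diagonal and becomes a metric only in the limit at the boundary.\<close>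

definition E :: "'a \<Rightarrow> 'a \<Rightarrow> real" where
  "E x y = exp (- \<epsilon> * gromov_prod p x y)"

lemma E_pos: "E x y > 0" and E_commute: "E x y = E y x"
  by (simp_all add: E_def gromov_prod_commute)

lemma E_triangle: "E x y \<le> E x z + E z y"
  using hyp by (simp add: strongly_hyperbolic_def E_def)

lemma gromov_prod_nonneg: "gromov_prod p x y \<ge> 0"
  using dist_triangle[of x y p] by (simp add: gromov_prod_def dist_commute)

lemma gromov_prod_le: "gromov_prod p x y \<le> dist p y"
  using dist_triangle[of x p y] by (simp add: gromov_prod_def dist_commute)

lemma E_le_1: "E x y \<le> 1"
  using eps gromov_prod_nonneg by (simp add: E_def)

lemma E_ge: "exp (- \<epsilon> * dist p y) \<le> E x y"
  using eps gromov_prod_le by (simp add: E_def)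

text \<open>Nonnegativity rules out the limit \<open>- \<infinity>\<close>. At
  \<open>\<infinity>\<close> the value 0 chosen in \<open>visual_dist\<close> is the correct limit,
  and at a real number continuity of the exponential applies.\<close>

lemma E_tendsto_prod:
  assumes bd: "\<xi> \<in> bdry" "\<eta> \<in> bdry" and uv: "u \<in> \<xi>" "v \<in> \<eta>"
  shows "((\<lambda>(m, n). E (u m) (v n)) \<longlongrightarrow> vd \<xi> \<eta>) (sequentially \<times>\<^sub>F sequentially)"
proof -
  let ?F = "sequentially \<times>\<^sub>F sequentially"
  note T = gromov_prod_bdry_tendsto[OF eps hyp bd uv]
  have "gromov_prod_bdry p \<xi> \<eta> \<ge> 0"
    by (rule tendsto_lowerbound[OF T]) (auto simp: prod_filter_eq_bot gromov_prod_nonneg case_prod_unfold)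
  then consider "gromov_prod_bdry p \<xi> \<eta> = \<infinity>" | l where "gromov_prod_bdry p \<xi> \<eta> = ereal l"
    by (cases "gromov_prod_bdry p \<xi> \<eta>") auto
  then show ?thesis
  proof cases
    case 1
    with T have L: "filterlim (\<lambda>(m, n). gromov_prod p (u m) (v n)) at_top ?F"
      by (simp add: case_prod_unfold tendsto_PInfty filterlim_at_top_dense)
    have "((\<lambda>x. E (u (fst x)) (v (snd x))) \<longlongrightarrow> 0) ?F"
    proof (rule tendstoI)
      fix e :: real assume "e > 0"
      with L obtain N where "\<forall>m\<ge>N. \<forall>n\<ge>N. E (u m) (v n) < e"
        unfolding filterlim_gromov_iff[OF eps] E_def by blast
      then show "eventually (\<lambda>x. dist (E (u (fst x)) (v (snd x))) 0 < e) ?F"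
        by (auto simp: eventually_prod_sequentially abs_of_pos[OF E_pos])
    qed
    with 1 show ?thesis by (simp add: visual_dist_def case_prod_unfold)
  next
    case 2
    with T have "((\<lambda>x. gromov_prod p (u (fst x)) (v (snd x))) \<longlongrightarrow> l) ?F"
      by (simp add: case_prod_unfold)
    then have "((\<lambda>x. E (u (fst x)) (v (snd x))) \<longlongrightarrow> exp (- \<epsilon> * l)) ?F"
      unfolding E_def by (intro tendsto_intros)
    with 2 show ?thesis by (simp add: visual_dist_def case_prod_unfold)
  qed
qed

lemma E_tendsto:
  assumes "\<xi> \<in> bdry" "\<eta> \<in> bdry" "u \<in> \<xi>" "v \<in> \<eta>"
  shows "(\<lambda>m. E (u m) (v m)) \<longlonglongrightarrow> vd \<xi> \<eta>"
proof -
  have "filterlim (\<lambda>m. (m, m)) (sequentially \<times>\<^sub>F sequentially) sequentially"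
    by (intro filterlim_Pair filterlim_ident)
  from filterlim_compose[OF E_tendsto_prod[OF assms] this] show ?thesis by simp
qed

lemma bdry_nonempty: "\<xi> \<in> bdry \<Longrightarrow> \<exists>u. u \<in> \<xi>"
  using in_quotient_imp_non_empty[OF equiv_gromov_rel[OF eps hyp]] unfolding gromov_boundary_def by blast

lemma vd_self: assumes "\<xi> \<in> bdry" shows "vd \<xi> \<xi> = 0"
proof -
  note EQ = equiv_gromov_rel[OF eps hyp, of p]
  obtain u where u: "u \<in> \<xi>" using bdry_nonempty[OF assms] ..
  have "(u, u) \<in> gromov_rel p"
    using assms u in_quotient_imp_in_rel[OF EQ] by (auto simp: gromov_boundary_def)
  then have L: "filterlim (\<lambda>(m, n). gromov_prod p (u m) (u n)) at_top (sequentially \<times>\<^sub>F sequentially)"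
    by (simp add: gromov_rel_def)
  have "(\<lambda>m. E (u m) (u m)) \<longlonglongrightarrow> 0"
  proof (rule tendstoI)
    fix e :: real assume "e > 0"
    with L obtain N where "\<forall>m\<ge>N. \<forall>n\<ge>N. E (u m) (u n) < e"
      unfolding filterlim_gromov_iff[OF eps] E_def by blast
    then show "eventually (\<lambda>m. dist (E (u m) (u m)) 0 < e) sequentially"
      by (auto simp: eventually_sequentially abs_of_pos[OF E_pos])
  qed
  with E_tendsto[OF assms assms u u] show ?thesis by (rule LIMSEQ_unique)
qed

text \<open>The triangle inequality is the limit of the one for \<open>E\<close>. If the distance is
  0, the double limit in \<open>E_tendsto_prod\<close> says that the products of two representing
  sequences tend to infinity, so their classes agree.\<close>

sublocale Metric_space bdry vd
proof
  fix \<xi> \<eta> \<zeta>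
  show "0 \<le> vd \<xi> \<eta>" by (simp add: visual_dist_def)
  show "vd \<xi> \<eta> = vd \<eta> \<xi>" by (simp add: visual_dist_def gromov_prod_bdry_commute)
  assume bd: "\<xi> \<in> bdry" "\<eta> \<in> bdry"
  obtain u v where uv: "u \<in> \<xi>" "v \<in> \<eta>" using bdry_nonempty bd by blast
  show "vd \<xi> \<eta> = 0 \<longleftrightarrow> \<xi> = \<eta>"
  proof
    assume "vd \<xi> \<eta> = 0"
    with E_tendsto_prod[OF bd uv] have *: "((\<lambda>x. E (u (fst x)) (v (snd x))) \<longlongrightarrow> 0) (sequentially \<times>\<^sub>F sequentially)"
      by (simp add: case_prod_unfold)
    have "\<exists>N. \<forall>m\<ge>N. \<forall>n\<ge>N. E (u m) (v n) < e" if "e > 0" for e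
      using order_tendstoD(2)[OF * that] by (auto simp: eventually_prod_sequentially)
    then have "filterlim (\<lambda>(m, n). gromov_prod p (u m) (v n)) at_top (sequentially \<times>\<^sub>F sequentially)"
      unfolding filterlim_gromov_iff[OF eps] E_def by blast
    moreover have "u \<in> gromov_seqs p" "v \<in> gromov_seqs p"
      using bd uv in_quotient_imp_subset[OF equiv_gromov_rel[OF eps hyp, of p]]
      unfolding gromov_boundary_def by blast+
    ultimately have "(u, v) \<in> gromov_rel p" by (simp add: gromov_rel_def)
    then show "\<xi> = \<eta>"
      using quotient_eqI[OF equiv_gromov_rel[OF eps hyp, of p]] bd uv unfolding gromov_boundary_def by blast
  next
    assume "\<xi> = \<eta>" then show "vd \<xi> \<eta> = 0" using vd_self bd by simp
  qed
  assume z: "\<zeta> \<in> bdry"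
  obtain w where w: "w \<in> \<zeta>" using bdry_nonempty[OF z] ..
  show "vd \<xi> \<zeta> \<le> vd \<xi> \<eta> + vd \<eta> \<zeta>"
    by (rule LIMSEQ_le[OF E_tendsto[OF bd(1) z uv(1) w]
        tendsto_add[OF E_tendsto[OF bd uv] E_tendsto[OF bd(2) z uv(2) w]]]) (use E_triangle in blast)
qed

text \<open>The continuous extension of \<^term>\<open>\<lambda>y. E y x\<close> to the boundary.\<close>

definition bE :: "'a bpoint \<Rightarrow> 'a \<Rightarrow> real" where
  "bE \<xi> x = lim (\<lambda>m. E ((SOME u. u \<in> \<xi>) m) x)"

text \<open>By the triangle inequality two values \<open>E a x\<close> and \<open>E b x\<close>
  differ by at most \<open>E a b\<close>. Hence a representing sequence gives a Cauchy sequence, and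
  equivalent sequences give the same limit.\<close>

lemma bE_tendsto:
  assumes xi: "\<xi> \<in> bdry" and u: "u \<in> \<xi>"
  shows "(\<lambda>m. E (u m) x) \<longlonglongrightarrow> bE \<xi> x"
proof -
  define w where "w = (SOME u. u \<in> \<xi>)"
  have w: "w \<in> \<xi>" unfolding w_def some_in_eq using u by blast
  have diff: "\<bar>E a x - E b x\<bar> \<le> E a b" for a b
    using E_triangle[of a x b] E_triangle[of b x a] by (simp add: abs_le_iff E_commute[of b a])
  have "Cauchy (\<lambda>m. E (w m) x)"
  proof (rule CauchyI)
    fix e :: real assume "e > 0"
    with E_tendsto_prod[OF xi xi w w]
    have "eventually (\<lambda>(m, n). E (w m) (w n) < e) (sequentially \<times>\<^sub>F sequentially)"
      by (simp add: order_tendstoD(2) case_prod_unfold vd_self[OF xi])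
    then obtain N where "E (w m) (w n) < e" if "m \<ge> N" "n \<ge> N" for m n
      by (auto simp: eventually_prod_sequentially)
    then show "\<exists>N. \<forall>m\<ge>N. \<forall>n\<ge>N. norm (E (w m) x - E (w n) x) < e"
      using diff by (metis real_norm_def order_le_less_trans)
  qed
  then have W: "(\<lambda>m. E (w m) x) \<longlonglongrightarrow> bE \<xi> x"
    by (simp add: bE_def w_def[symmetric] Cauchy_convergent convergent_LIMSEQ_iff[symmetric])
  have "(\<lambda>m. E (u m) x - E (w m) x) \<longlonglongrightarrow> 0"
    by (rule Lim_null_comparison[OF _ E_tendsto[OF xi xi u w, unfolded vd_self[OF xi]]])
      (simp add: diff)
  from tendsto_add[OF this W] show ?thesis by simp
qed

lemma bE_le_1: "\<xi> \<in> bdry \<Longrightarrow> bE \<xi> x \<le> 1"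
  using bdry_nonempty bE_tendsto E_le_1 by (meson LIMSEQ_le_const2)

lemma bE_ge: "\<xi> \<in> bdry \<Longrightarrow> exp (- \<epsilon> * dist p x) \<le> bE \<xi> x"
  using bdry_nonempty bE_tendsto E_ge by (meson LIMSEQ_le_const)

lemma bE_pos: "\<xi> \<in> bdry \<Longrightarrow> bE \<xi> x > 0"
  using bE_ge[of \<xi> x] exp_gt_zero[of "- \<epsilon> * dist p x"] by linarith

section \<open>Triangle inequalities that mix points of the space and of the boundary\<close>

lemma bE_Lipschitz:
  assumes "\<xi> \<in> bdry" "\<eta> \<in> bdry"
  shows "bE \<xi> x \<le> vd \<xi> \<eta> + bE \<eta> x"
proof -
  obtain u v where uv: "u \<in> \<xi>" "v \<in> \<eta>" using bdry_nonempty assms by blast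
  show ?thesis
    by (rule LIMSEQ_le[OF bE_tendsto[OF assms(1) uv(1)]
        tendsto_add[OF E_tendsto[OF assms uv] bE_tendsto[OF assms(2) uv(2)]]]) (use E_triangle in blast)
qed

lemma E_bE_triangle:
  assumes "\<xi> \<in> bdry"
  shows "E x y \<le> bE \<xi> x + bE \<xi> y"
proof -
  obtain u where u: "u \<in> \<xi>" using bdry_nonempty assms by blast
  have "E x y \<le> E (u m) x + E (u m) y" for m
    using E_triangle[of x y "u m"] by (simp add: E_commute[of x])
  then show ?thesis
    by (intro LIMSEQ_le_const[OF tendsto_add[OF bE_tendsto[OF assms u] bE_tendsto[OF assms u]]]) auto
qed

lemma bE_E_triangle:
  assumes "\<xi> \<in> bdry"
  shows "bE \<xi> x \<le> bE \<xi> y + E y x"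
proof -
  obtain u where u: "u \<in> \<xi>" using bdry_nonempty assms by blast
  show ?thesis
    by (rule LIMSEQ_le[OF bE_tendsto[OF assms u] tendsto_add[OF bE_tendsto[OF assms u] tendsto_const]])
      (use E_triangle in blast)
qed

section \<open>The group and the change of base point\<close>

lemma \<Gamma>_bij: "\<gamma> \<in> \<Gamma> \<Longrightarrow> bij \<gamma>"
  using isom subgroup.subset[of \<Gamma> "BijGroup UNIV"]
  by (auto simp: isometry_group_def BijGroup_def Bij_def)

lemma \<Gamma>_dist: "\<gamma> \<in> \<Gamma> \<Longrightarrow> dist (\<gamma> x) (\<gamma> y) = dist x y"
  using isom by (simp add: isometry_group_def)

lemma \<Gamma>_inv: assumes "\<gamma> \<in> \<Gamma>" shows "inv_into UNIV \<gamma> \<in> \<Gamma>"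
proof -
  have "\<gamma> \<in> Bij UNIV" using \<Gamma>_bij[OF assms] by (simp add: Bij_def)
  then have "m_inv (BijGroup UNIV) \<gamma> = inv_into UNIV \<gamma>" by (simp add: inv_BijGroup restrict_def)
  with isom assms show ?thesis
    by (metis isometry_group_def subgroup.m_inv_closed)
qed

lemma \<Gamma>_comp: assumes "\<gamma> \<in> \<Gamma>" "\<delta> \<in> \<Gamma>" shows "\<gamma> \<circ> \<delta> \<in> \<Gamma>"
proof -
  have "\<gamma> \<in> Bij UNIV" "\<delta> \<in> Bij UNIV" using \<Gamma>_bij assms by (simp_all add: Bij_def)
  then have "\<gamma> \<otimes>\<^bsub>BijGroup UNIV\<^esub> \<delta> = \<gamma> \<circ> \<delta>" by (simp add: BijGroup_def compose_def fun_eq_iff)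
  with isom assms show ?thesis
    by (metis isometry_group_def subgroup.m_closed)
qed

lemma \<Gamma>_inv_app:
  assumes "\<gamma> \<in> \<Gamma>"
  shows "inv_into UNIV \<gamma> (\<gamma> x) = x" "\<gamma> (inv_into UNIV \<gamma> x) = x"
  using \<Gamma>_bij[OF assms] by (simp_all add: bij_is_inj bij_is_surj surj_f_inv_f)

lemma dist_inv:
  assumes "\<gamma> \<in> \<Gamma>"
  shows "dist (inv_into UNIV \<gamma> x) y = dist x (\<gamma> y)"
  using \<Gamma>_dist[OF assms, of "inv_into UNIV \<gamma> x" y] by (simp add: \<Gamma>_inv_app[OF assms])

text \<open>By invariance the left side is the Gromov product of \<open>x\<close> and
  \<open>y\<close> based at \<open>\<gamma> p\<close>; the remaining terms rewrite it with base
  point \<open>p\<close>.\<close>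

lemma gromov_prod_inv:
  assumes "\<gamma> \<in> \<Gamma>"
  shows "gromov_prod p (inv_into UNIV \<gamma> x) (inv_into UNIV \<gamma> y) =
    gromov_prod p x y + dist p (\<gamma> p) - gromov_prod p x (\<gamma> p) - gromov_prod p y (\<gamma> p)"
  using assms by (simp add: gromov_prod_def dist_inv \<Gamma>_inv \<Gamma>_dist dist_commute[of p] \<Gamma>_inv_app field_simps)

lemma E_inv:
  assumes "\<gamma> \<in> \<Gamma>"
  shows "E (inv_into UNIV \<gamma> x) (inv_into UNIV \<gamma> y) =
    E x y * exp (- \<epsilon> * dist p (\<gamma> p)) / (E x (\<gamma> p) * E y (\<gamma> p))"
  unfolding E_def gromov_prod_inv[OF assms]
  by (simp only: exp_add[symmetric] exp_diff[symmetric]) (simp add: algebra_simps)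

lemma E_inv_base:
  assumes "\<gamma> \<in> \<Gamma>"
  shows "E (inv_into UNIV \<gamma> x) (inv_into UNIV \<gamma> p) = exp (- \<epsilon> * dist p (\<gamma> p)) / E x (\<gamma> p)"
proof -
  have *: "gromov_prod p (inv_into UNIV \<gamma> x) (inv_into UNIV \<gamma> p) = dist p (\<gamma> p) - gromov_prod p x (\<gamma> p)"
    using assms by (simp add: gromov_prod_def dist_inv \<Gamma>_inv \<Gamma>_dist dist_commute[of p] \<Gamma>_inv_app field_simps)
  show ?thesis unfolding E_def * by (simp add: exp_diff[symmetric] algebra_simps)
qed

text \<open>Moving the base point by \<open>dist p (\<gamma> p)\<close> changes Gromov products by
  at most that amount. This crude bound suffices for \<open>\<gamma>\<close> to act on the boundary
  by continuous maps.\<close>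

lemma E_iso_le:
  assumes "\<gamma> \<in> \<Gamma>"
  shows "E (\<gamma> x) (\<gamma> y) \<le> exp (\<epsilon> * dist p (\<gamma> p)) * E x y"
proof -
  have "dist x p \<le> dist (\<gamma> x) p + dist p (\<gamma> p)" "dist y p \<le> dist (\<gamma> y) p + dist p (\<gamma> p)"
    using dist_triangle[of "\<gamma> x" "\<gamma> p" p] dist_triangle[of "\<gamma> y" "\<gamma> p" p] \<Gamma>_dist[OF assms] by simp_all
  then have "gromov_prod p x y \<le> gromov_prod p (\<gamma> x) (\<gamma> y) + dist p (\<gamma> p)"
    by (simp add: gromov_prod_def \<Gamma>_dist[OF assms] divide_simps)
  then have "\<epsilon> * gromov_prod p x y \<le> \<epsilon> * (gromov_prod p (\<gamma> x) (\<gamma> y) + dist p (\<gamma> p))"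
    using eps by (intro mult_left_mono) auto
  then show ?thesis by (simp add: E_def exp_add[symmetric] algebra_simps)
qed

section \<open>The action on the boundary\<close>

lemma gromov_rel_iso:
  assumes g: "\<gamma> \<in> \<Gamma>" and uv: "(u, v) \<in> gromov_rel p"
  shows "(\<gamma> \<circ> u, \<gamma> \<circ> v) \<in> gromov_rel p"
proof -
  note F = filterlim_gromov_iff[OF eps, where p = p, folded E_def]
  have *: "\<forall>e>0. \<exists>N. \<forall>m\<ge>N. \<forall>n\<ge>N. E ((\<gamma> \<circ> a) m) ((\<gamma> \<circ> b) n) < e"
    if ab: "\<forall>e>0. \<exists>N. \<forall>m\<ge>N. \<forall>n\<ge>N. E (a m) (b n) < e" for a b :: "nat \<Rightarrow> 'a"
  proof (intro allI impI)
    fix e :: real assume "e > 0"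
    let ?L = "exp (\<epsilon> * dist p (\<gamma> p))"
    obtain N where N: "\<forall>m\<ge>N. \<forall>n\<ge>N. E (a m) (b n) < e / ?L"
      using ab \<open>e > 0\<close> by (meson divide_pos_pos exp_gt_zero)
    have "E ((\<gamma> \<circ> a) m) ((\<gamma> \<circ> b) n) < e" if "m \<ge> N" "n \<ge> N" for m n
    proof -
      have "E (\<gamma> (a m)) (\<gamma> (b n)) \<le> ?L * E (a m) (b n)" by (rule E_iso_le[OF g])
      also have "\<dots> < ?L * (e / ?L)" using N that by (intro mult_strict_left_mono) auto
      finally show ?thesis by simp
    qed
    then show "\<exists>N. \<forall>m\<ge>N. \<forall>n\<ge>N. E ((\<gamma> \<circ> a) m) ((\<gamma> \<circ> b) n) < e" by blast
  qed
  show ?thesis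
    using uv unfolding gromov_rel_def gromov_seqs_def F mem_Collect_eq prod.case
    by (elim conjE) (intro conjI; rule *; assumption)
qed

lemma bdry_map_inv:
  assumes "\<gamma> \<in> \<Gamma>"
  shows "bdry_map (inv_into UNIV \<gamma>) (bdry_map \<gamma> \<xi>) = \<xi>" "bdry_map \<gamma> (bdry_map (inv_into UNIV \<gamma>) \<xi>) = \<xi>"
  by (simp_all add: bdry_map_def image_image comp_def \<Gamma>_inv_app[OF assms])

text \<open>Since the inverse of \<open>\<gamma>\<close> preserves the relation as well, the image
  of a class is a whole class and not just part of one.\<close>

lemma bdry_map_in:
  assumes g: "\<gamma> \<in> \<Gamma>" and xi: "\<xi> \<in> bdry"
  shows "bdry_map \<gamma> \<xi> \<in> bdry"
proof -
  obtain u where u: "u \<in> gromov_seqs p" "\<xi> = gromov_rel p `` {u}"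
    using xi unfolding gromov_boundary_def by (auto elim: quotientE)
  have inv: "\<gamma> \<circ> (inv_into UNIV \<gamma> \<circ> v) = v" "inv_into UNIV \<gamma> \<circ> (\<gamma> \<circ> v) = v" for v :: "nat \<Rightarrow> 'a"
    by (simp_all add: fun_eq_iff \<Gamma>_inv_app[OF g])
  have "bdry_map \<gamma> \<xi> = gromov_rel p `` {\<gamma> \<circ> u}"
  proof (intro Set.set_eqI iffI)
    fix v assume "v \<in> gromov_rel p `` {\<gamma> \<circ> u}"
    then have "(u, inv_into UNIV \<gamma> \<circ> v) \<in> gromov_rel p"
      using gromov_rel_iso[OF \<Gamma>_inv[OF g], of "\<gamma> \<circ> u" v] by (simp add: inv)
    then have "inv_into UNIV \<gamma> \<circ> v \<in> \<xi>" by (simp add: u)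
    then show "v \<in> bdry_map \<gamma> \<xi>" unfolding bdry_map_def by (rule rev_image_eqI) (simp add: inv)
  qed (use gromov_rel_iso[OF g] u in \<open>auto simp: bdry_map_def\<close>)
  moreover have "\<gamma> \<circ> u \<in> gromov_seqs p"
    using gromov_rel_iso[OF g, of u u] u(1) by (simp add: gromov_rel_def gromov_seqs_def)
  ultimately show ?thesis unfolding gromov_boundary_def by (metis quotientI)
qed

text \<open>The limit of \<open>E_inv\<close>; the quotients converge because \<open>bE\<close> is
  positive. This is the conformal factor of the action.\<close>

lemma vd_inv:
  assumes g: "\<gamma> \<in> \<Gamma>" and bd: "\<xi> \<in> bdry" "\<eta> \<in> bdry"
  shows "vd (bdry_map (inv_into UNIV \<gamma>) \<xi>) (bdry_map (inv_into UNIV \<gamma>) \<eta>) =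
    vd \<xi> \<eta> * exp (- \<epsilon> * dist p (\<gamma> p)) / (bE \<xi> (\<gamma> p) * bE \<eta> (\<gamma> p))"
proof -
  obtain u v where uv: "u \<in> \<xi>" "v \<in> \<eta>" using bdry_nonempty bd by blast
  let ?i = "inv_into UNIV \<gamma>"
  have "?i \<circ> u \<in> bdry_map ?i \<xi>" "?i \<circ> v \<in> bdry_map ?i \<eta>"
    using uv by (auto simp: bdry_map_def)
  from E_tendsto[OF bdry_map_in[OF \<Gamma>_inv[OF g] bd(1)] bdry_map_in[OF \<Gamma>_inv[OF g] bd(2)] this]
  have "(\<lambda>m. E (u m) (v m) * exp (- \<epsilon> * dist p (\<gamma> p)) / (E (u m) (\<gamma> p) * E (v m) (\<gamma> p)))
     \<longlonglongrightarrow> vd (bdry_map ?i \<xi>) (bdry_map ?i \<eta>)"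
    by (simp add: E_inv[OF g])
  moreover have "(\<lambda>m. E (u m) (v m) * exp (- \<epsilon> * dist p (\<gamma> p)) / (E (u m) (\<gamma> p) * E (v m) (\<gamma> p)))
     \<longlonglongrightarrow> vd \<xi> \<eta> * exp (- \<epsilon> * dist p (\<gamma> p)) / (bE \<xi> (\<gamma> p) * bE \<eta> (\<gamma> p))"
    using bE_pos[OF bd(1), of "\<gamma> p"] bE_pos[OF bd(2), of "\<gamma> p"]
    by (intro tendsto_intros E_tendsto[OF bd uv] bE_tendsto[OF bd(1) uv(1)] bE_tendsto[OF bd(2) uv(2)]) simp
  ultimately show ?thesis by (rule LIMSEQ_unique)
qed

text \<open>If \<open>\<xi>\<close> has product about \<open>k\<close> with
  \<open>\<gamma> p\<close> and the displacement of \<open>\<gamma>\<close> is about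
  \<open>n\<close>, then the preimage of \<open>\<xi>\<close> has product about \<open>n - k\<close>
  with the preimage of \<open>p\<close>.\<close>

lemma bE_inv_base:
  assumes g: "\<gamma> \<in> \<Gamma>" and bd: "\<xi> \<in> bdry"
  shows "bE (bdry_map (inv_into UNIV \<gamma>) \<xi>) (inv_into UNIV \<gamma> p) = exp (- \<epsilon> * dist p (\<gamma> p)) / bE \<xi> (\<gamma> p)"
proof -
  obtain u where u: "u \<in> \<xi>" using bdry_nonempty bd by blast
  let ?i = "inv_into UNIV \<gamma>"
  have "?i \<circ> u \<in> bdry_map ?i \<xi>" using u by (auto simp: bdry_map_def)
  from bE_tendsto[OF bdry_map_in[OF \<Gamma>_inv[OF g] bd] this, of "?i p"]
  have "(\<lambda>m. exp (- \<epsilon> * dist p (\<gamma> p)) / E (u m) (\<gamma> p)) \<longlonglongrightarrow> bE (bdry_map ?i \<xi>) (?i p)"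
    by (simp add: E_inv_base[OF g])
  moreover have "(\<lambda>m. exp (- \<epsilon> * dist p (\<gamma> p)) / E (u m) (\<gamma> p)) \<longlonglongrightarrow> exp (- \<epsilon> * dist p (\<gamma> p)) / bE \<xi> (\<gamma> p)"
    using bE_pos[OF bd, of "\<gamma> p"]
    by (intro tendsto_intros bE_tendsto[OF bd u]) simp
  ultimately show ?thesis by (rule LIMSEQ_unique)
qed

end

section \<open>Levels of the Gromov product\<close>

context strongly_hyperbolic_action
begin

text \<open>As \<open>bE\<close> decreases in the Gromov product, the interval closed at
  \<open>k\<close> and open at \<open>k + 1\<close> turns into one that is open below and closed
  above.\<close>

definition level :: "('a \<Rightarrow> 'a) \<Rightarrow> nat \<Rightarrow> 'a bpoint set" where
  "level \<gamma> k = {\<xi> \<in> bdry. exp (- \<epsilon> * (real k + 1)) < bE \<xi> (\<gamma> p) \<and> bE \<xi> (\<gamma> p) \<le> exp (- \<epsilon> * real k)}"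

text \<open>Used with \<open>\<eta> = \<gamma>\<inverse>\<xi>\<close>, where \<open>\<xi>\<close> lies in level \<open>k\<close> of both \<open>\<gamma>\<close> and \<open>\<gamma>'\<close>.\<close>

definition level_fibre :: "nat \<Rightarrow> nat \<Rightarrow> ('a \<Rightarrow> 'a) \<Rightarrow> 'a bpoint \<Rightarrow> ('a \<Rightarrow> 'a) set" where
  "level_fibre n k \<gamma>' \<eta> = {\<gamma> \<in> annulus \<Gamma> p n 1.
     E (\<gamma> p) (\<gamma>' p) \<le> 2 * exp (- \<epsilon> * real k) \<and> bdry_map \<gamma> \<eta> \<in> level \<gamma> k}"

section \<open>Counting group elements\<close>

lemma gromov_prod_ge:
  assumes "E x y \<le> c * exp (- \<epsilon> * t)" "c > 0"
  shows "t - ln c / \<epsilon> \<le> gromov_prod p x y"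
proof -
  have "exp (- \<epsilon> * gromov_prod p x y) \<le> exp (ln c - \<epsilon> * t)"
    using assms by (simp add: E_def exp_diff exp_minus field_simps)
  then have "\<epsilon> * (t - ln c / \<epsilon>) \<le> \<epsilon> * gromov_prod p x y"
    using eps by (simp add: algebra_simps)
  then show ?thesis using eps by simp
qed

lemma dist_eq_gromov_prod: "dist x y = dist p x + dist p y - 2 * gromov_prod p x y"
  by (simp add: gromov_prod_def dist_commute field_simps)

text \<open>Conjugation by an \<open>h\<close> that carries a point \<open>y\<close> of the compact
  set \<open>K\<close> to \<open>x\<close> preserves the displacement. The conjugates move
  \<open>y\<close> by at most \<open>c\<close>, so they all belong to the finite set
  \<open>S\<close>, which does not depend on \<open>x\<close>.\<close>

lemma card_small_displacement_le:
  assumes "proper_space TYPE('a)" "properly_discontinuous \<Gamma>" "cocompact \<Gamma>"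
  shows "\<exists>N. \<forall>x. finite {g \<in> \<Gamma>. dist (g x) x \<le> c} \<and> card {g \<in> \<Gamma>. dist (g x) x \<le> c} \<le> N"
proof -
  obtain K where K: "compact K" "(\<Union>\<gamma>\<in>\<Gamma>. \<gamma> ` K) = UNIV"
    using assms(3) unfolding cocompact_def by blast
  obtain r where r: "K \<subseteq> cball p r"
    using compact_imp_bounded[OF K(1)] unfolding bounded_any_center[where a = p] by (auto simp: subset_eq)
  define K' where "K' = cball p (r + c)"
  define S where "S = {g \<in> \<Gamma>. g ` K' \<inter> K' \<noteq> {}}"
  have "compact K'" using assms(1) by (simp add: proper_space_def K'_def)
  then have S: "finite S" using assms(2) by (simp add: S_def properly_discontinuous_def)
  show ?thesis
  proof (intro exI[of _ "card S"] allI)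
    fix x
    define A where "A = {g \<in> \<Gamma>. dist (g x) x \<le> c}"
    obtain h y where hy: "h \<in> \<Gamma>" "y \<in> K" "x = h y" using K(2) by blast
    define \<phi> where "\<phi> g = inv_into UNIV h \<circ> g \<circ> h" for g :: "'a \<Rightarrow> 'a"
    have inj: "inj_on \<phi> A"
    proof (rule inj_onI)
      fix g g' assume "\<phi> g = \<phi> g'"
      then have "h (\<phi> g (inv_into UNIV h z)) = h (\<phi> g' (inv_into UNIV h z))" for z by simp
      then show "g = g'" by (simp add: \<phi>_def \<Gamma>_inv_app[OF hy(1)] fun_eq_iff)
    qed
    have img: "\<phi> ` A \<subseteq> S"
    proof
      fix f assume "f \<in> \<phi> ` A"
      then obtain g where g: "g \<in> \<Gamma>" "dist (g x) x \<le> c" "f = \<phi> g" by (auto simp: A_def)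
      have "f \<in> \<Gamma>" using g hy by (simp add: \<phi>_def \<Gamma>_comp \<Gamma>_inv)
      have c: "c \<ge> 0" using g(2) zero_le_dist[of "g x" x] by linarith
      have "dist (f y) y \<le> c" using g hy by (simp add: \<phi>_def dist_inv)
      moreover have "dist p y \<le> r" using r hy by auto
      ultimately have "f y \<in> K'" "y \<in> K'"
        using dist_triangle[of p "f y" y] c by (simp_all add: K'_def dist_commute)
      with \<open>f \<in> \<Gamma>\<close> show "f \<in> S" by (auto simp: S_def)
    qed
    show "finite A \<and> card A \<le> card S"
      using inj_on_finite[OF inj img S] card_inj_on_le[OF inj img S] by simp
  qed
qed

text \<open>Let \<open>x\<close> be the point at distance \<open>k\<close> from \<open>p\<close> on a rough geodesic from \<open>p\<close> to \<open>\<gamma>'p\<close>. For every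
  \<open>\<gamma>\<close> in the fibre, \<open>\<gamma>\<inverse>x\<close> is within bounded distance of the point at distance \<open>n - k\<close> from \<open>p\<close> in the
  direction of \<open>\<eta>\<close>, so any two elements of the fibre differ by a group element that moves \<open>x\<close> by a
  bounded amount.\<close>

lemma card_level_fibre_le:
  assumes "proper_space TYPE('a)" "roughly_geodesic TYPE('a)" "properly_discontinuous \<Gamma>" "cocompact \<Gamma>"
  shows "\<exists>N. \<forall>n k \<eta> \<gamma>'. k \<le> n \<longrightarrow> \<eta> \<in> bdry \<longrightarrow> \<gamma>' \<in> annulus \<Gamma> p n 1 \<longrightarrow>
    finite (level_fibre n k \<gamma>' \<eta>) \<and> card (level_fibre n k \<gamma>' \<eta>) \<le> N"
proof -
  obtain C where C: "C > 0" and geo: "\<And>x y :: 'a. \<exists>(a::real) b r. a \<le> b \<and> r a = x \<and> r b = y \<and>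
     (\<forall>t\<in>{a..b}. \<forall>u\<in>{a..b}.
        \<bar>t - u\<bar> - C \<le> dist (r t) (r u) \<and> dist (r t) (r u) \<le> \<bar>t - u\<bar> + C)"
    using assms(2) unfolding roughly_geodesic_def by blast
  \<comment> \<open>\<open>c1\<close> adds the error \<open>5 * C / 2\<close> along the rough
    geodesic and the factor 2 of \<open>level_fibre\<close>. \<open>b1\<close> collects the error in
    \<open>dist p x\<close>, the width 1 of the annulus and twice the logarithmic loss of
    \<open>gromov_prod_ge\<close>. \<open>c2\<close> and \<open>c\<close> do the same for the
    distance between two preimages of \<open>x\<close>.\<close>
  define c1 where "c1 = exp (\<epsilon> * (5 * C / 2)) + 2"
  define b1 where "b1 = C + 1 + 2 * (ln c1 / \<epsilon>)"
  define c2 where "c2 = 2 * (exp \<epsilon> + exp (\<epsilon> * C))"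
  define c where "c = 2 * b1 + 2 * (ln c2 / \<epsilon>)"
  have c1: "c1 > 0" and c2: "c2 > 0" by (simp_all add: c1_def c2_def add_pos_pos)
  obtain N where N: "\<And>x. finite {g \<in> \<Gamma>. dist (g x) x \<le> c}" "\<And>x. card {g \<in> \<Gamma>. dist (g x) x \<le> c} \<le> N"
    using card_small_displacement_le[OF assms(1,3,4)] by blast
  show ?thesis
  proof (intro exI[of _ N] allI impI)
    fix n k :: nat and \<eta> \<gamma>'
    assume kn: "k \<le> n" and eta: "\<eta> \<in> bdry" and g': "\<gamma>' \<in> annulus \<Gamma> p n 1"
    define A where "A = level_fibre n k \<gamma>' \<eta>"
    note A_def = A_def[unfolded level_fibre_def]
    obtain a b r where ab: "a \<le> b" "r a = p" "r b = \<gamma>' p"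
      and r: "\<And>t u. t \<in> {a..b} \<Longrightarrow> u \<in> {a..b} \<Longrightarrow> \<bar>t - u\<bar> - C \<le> dist (r t) (r u) \<and> dist (r t) (r u) \<le> \<bar>t - u\<bar> + C"
      using geo[of p "\<gamma>' p"] by blast
    have g'n: "real n \<le> dist p (\<gamma>' p)" using g' by (simp add: annulus_def)
    \<comment> \<open>The parameter interval is only known to have length at least
      \<open>n - C\<close>, so \<open>a + k\<close> may lie beyond \<open>b\<close>.\<close>
    define x where "x = r (min (a + k) b)"
    have t: "min (a + k) b \<in> {a..b}" using ab by auto
    have ba: "b - a \<ge> n - C" using r[of a b] ab g'n by simp
    have px: "dist p x \<le> k + C" using r[OF _ t, of a] ab by (auto simp: x_def min_def)
    have "gromov_prod p x (\<gamma>' p) \<ge> k - 5 * C / 2"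
    proof -
      have "dist p x \<ge> min (a + k) b - a - C" using r[OF _ t, of a] ab by (auto simp: x_def)
      moreover have "dist x (\<gamma>' p) \<le> b - min (a + k) b + C"
        using r[OF t, of b] ab by (auto simp: x_def min_def split: if_splits)
      moreover have "dist p (\<gamma>' p) \<ge> b - a - C" using r[of a b] ab by simp
      moreover have "min (a + k) b - a \<ge> k - C" using ba kn C by (simp add: min_def)
      ultimately show ?thesis by (simp add: gromov_prod_def dist_commute)
    qed
    then have "E x (\<gamma>' p) \<le> exp (- \<epsilon> * (k - 5 * C / 2))"
      unfolding E_def using eps by simp
    then have xg': "E x (\<gamma>' p) \<le> exp (\<epsilon> * (5 * C / 2)) * exp (- \<epsilon> * real k)"
      by (simp add: exp_add[symmetric] algebra_simps)
    have px_y: "dist p (inv_into UNIV \<gamma> x) \<le> real n - k + b1"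
      and bE_y: "bE \<eta> (inv_into UNIV \<gamma> x) \<le> c2 / 2 * exp (- \<epsilon> * (real n - k))" if "\<gamma> \<in> A" for \<gamma>
    proof -
      from that have g: "\<gamma> \<in> \<Gamma>" "real n \<le> dist p (\<gamma> p)" "dist p (\<gamma> p) \<le> real n + 1"
        "E (\<gamma> p) (\<gamma>' p) \<le> 2 * exp (- \<epsilon> * real k)" "bdry_map \<gamma> \<eta> \<in> level \<gamma> k"
        by (auto simp: A_def annulus_def)
      have "E x (\<gamma> p) \<le> c1 * exp (- \<epsilon> * real k)"
        using E_triangle[of x "\<gamma> p" "\<gamma>' p"] xg' g(4) by (simp add: E_commute[of "\<gamma>' p"] c1_def algebra_simps)
      from gromov_prod_ge[OF this c1] have "dist x (\<gamma> p) \<le> real n - k + b1"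
        using px g(3) unfolding dist_eq_gromov_prod[of x] b1_def by simp
      then show "dist p (inv_into UNIV \<gamma> x) \<le> real n - k + b1"
        by (simp add: dist_commute[of p] dist_inv[OF g(1)])
      \<comment> \<open>Used with \<open>s = k + C\<close> for the preimage of \<open>x\<close> and
        with \<open>s = k + 1\<close> for \<open>\<eta>\<close>: both have product at least
        \<open>n - k\<close>, up to a constant, with the preimage of \<open>p\<close>.\<close>
      have *: "exp (- \<epsilon> * dist p (\<gamma> p)) / z \<le> exp (\<epsilon> * (s - k)) * exp (- \<epsilon> * (real n - k))"
        if "z \<ge> exp (- \<epsilon> * s)" for z s
      proof -
        have "exp (- \<epsilon> * dist p (\<gamma> p)) / z \<le> exp (- \<epsilon> * n) / exp (- \<epsilon> * s)"
          using that g(2) eps by (intro frac_le) auto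
        also have "\<dots> = exp (\<epsilon> * (s - k)) * exp (- \<epsilon> * (real n - k))"
          by (simp only: exp_add[symmetric] exp_diff[symmetric]) (simp add: algebra_simps)
        finally show ?thesis .
      qed
      let ?q = "inv_into UNIV \<gamma> p"
      have "E x (\<gamma> p) \<ge> exp (- \<epsilon> * (k + C))"
        using E_ge[of x "\<gamma> p"] E_ge[of "\<gamma> p" x] px eps unfolding E_commute[of "\<gamma> p"]
        by (elim order_trans[rotated]) simp
      from *[OF this] have 1: "E (inv_into UNIV \<gamma> x) ?q \<le> exp (\<epsilon> * C) * exp (- \<epsilon> * (real n - k))"
        by (simp add: E_inv_base[OF g(1)])
      have "bE (bdry_map \<gamma> \<eta>) (\<gamma> p) \<ge> exp (- \<epsilon> * (real k + 1))" using g(5) by (simp add: level_def)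
      from *[OF this] have "bE \<eta> ?q \<le> exp \<epsilon> * exp (- \<epsilon> * (real n - k))"
        using bE_inv_base[OF g(1) bdry_map_in[OF g(1) eta]] by (simp add: bdry_map_inv[OF g(1)])
      with 1 bE_E_triangle[OF eta, of "inv_into UNIV \<gamma> x" ?q]
      show "bE \<eta> (inv_into UNIV \<gamma> x) \<le> c2 / 2 * exp (- \<epsilon> * (real n - k))"
        by (simp add: E_commute[of ?q] c2_def algebra_simps)
    qed
    have "finite A \<and> card A \<le> N"
    proof (cases "A = {}")
      case False
      then obtain \<gamma>\<^sub>1 where g1: "\<gamma>\<^sub>1 \<in> A" by blast
      have G1: "\<gamma>\<^sub>1 \<in> \<Gamma>" using g1 by (simp add: A_def annulus_def)
      \<comment> \<open>\<open>\<phi> \<gamma>\<close> displaces \<open>x\<close> by exactly the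
        distance between the preimages of \<open>x\<close> under \<open>\<gamma>\<close> and
        \<open>\<gamma>\<^sub>1\<close>.\<close>
      define \<phi> where "\<phi> \<gamma> = \<gamma> \<circ> inv_into UNIV \<gamma>\<^sub>1" for \<gamma> :: "'a \<Rightarrow> 'a"
      have inj: "inj_on \<phi> A"
      proof (rule inj_onI)
        fix g g' assume "\<phi> g = \<phi> g'"
        then have "\<phi> g (\<gamma>\<^sub>1 z) = \<phi> g' (\<gamma>\<^sub>1 z)" for z by simp
        then show "g = g'" by (simp add: \<phi>_def \<Gamma>_inv_app[OF G1] fun_eq_iff)
      qed
      have "\<phi> ` A \<subseteq> {g \<in> \<Gamma>. dist (g x) x \<le> c}"
      proof
        fix f assume "f \<in> \<phi> ` A"
        then obtain g where g: "g \<in> A" "f = \<phi> g" by blast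
        have G: "g \<in> \<Gamma>" using g by (simp add: A_def annulus_def)
        let ?y1 = "inv_into UNIV \<gamma>\<^sub>1 x" and ?y = "inv_into UNIV g x"
        have "E ?y1 ?y \<le> c2 * exp (- \<epsilon> * (real n - k))"
          using E_bE_triangle[OF eta, of ?y1 ?y] bE_y[OF g1] bE_y[OF g(1)] by simp
        from gromov_prod_ge[OF this c2] have "dist ?y1 ?y \<le> c"
          using px_y[OF g1] px_y[OF g(1)] unfolding dist_eq_gromov_prod[of ?y1] c_def by simp
        then have "dist (f x) x \<le> c"
          using dist_inv[OF G, of x ?y1] by (simp add: g(2) \<phi>_def dist_commute)
        then show "f \<in> {g \<in> \<Gamma>. dist (g x) x \<le> c}" using \<Gamma>_comp[OF G \<Gamma>_inv[OF G1]] by (simp add: g(2) \<phi>_def)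
      qed
      from inj_on_finite[OF inj this N(1)] card_inj_on_le[OF inj this N(1)] N(2) show ?thesis
        by (meson order_trans)
    qed simp
    then show "finite (level_fibre n k \<gamma>' \<eta>) \<and> card (level_fibre n k \<gamma>' \<eta>) \<le> N" unfolding A_def level_fibre_def .
  qed
qed

section \<open>Levels and the scaling of the visual distance\<close>

lemma E_le_of_common_level:
  assumes "\<xi> \<in> level \<gamma> k" "\<xi> \<in> level \<gamma>' k"
  shows "E (\<gamma> p) (\<gamma>' p) \<le> 2 * exp (- \<epsilon> * real k)"
  using E_bE_triangle[of \<xi> "\<gamma> p" "\<gamma>' p"] assms by (simp add: level_def)

text \<open>The product \<open>t\<close> of \<open>\<xi>\<close> and \<open>\<gamma> p\<close> is at
  least 0 and at most the displacement of \<open>\<gamma>\<close>, hence below \<open>n + 1\<close>.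
  Its floor is the level.\<close>

lemma level_cover:
  assumes "\<xi> \<in> bdry" "\<gamma> \<in> annulus \<Gamma> p n 1"
  shows "\<exists>k\<le>n. \<xi> \<in> level \<gamma> k"
proof -
  define t where "t = - ln (bE \<xi> (\<gamma> p)) / \<epsilon>"
  have bt: "bE \<xi> (\<gamma> p) = exp (- \<epsilon> * t)" using eps bE_pos[OF assms(1)] by (simp add: t_def)
  have "t \<ge> 0" using bE_le_1[OF assms(1), of "\<gamma> p"] eps by (simp add: bt zero_le_mult_iff)
  have "t < real n + 1"
    using bE_ge[OF assms(1), of "\<gamma> p"] eps assms(2) by (simp add: bt annulus_def)
  define k where "k = nat \<lfloor>t\<rfloor>"
  have "real k \<le> t" "t < real k + 1" using \<open>t \<ge> 0\<close> unfolding k_def by linarith+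
  then have "k \<le> n" "\<xi> \<in> level \<gamma> k"
    using assms eps \<open>t < real n + 1\<close> by (auto simp: level_def bt)
  then show ?thesis by blast
qed

text \<open>Bounds for the factor in \<open>vd_inv\<close>. The 2 in the first exponent comes from
  the unit width of the level, once for each of the two values of \<open>bE\<close>; the 1 in the
  second comes from the width of the annulus.\<close>

lemma vd_inv_le:
  assumes "\<gamma> \<in> annulus \<Gamma> p n 1" "\<xi> \<in> level \<gamma> k" "\<eta> \<in> level \<gamma> k"
  shows "vd (bdry_map (inv_into UNIV \<gamma>) \<xi>) (bdry_map (inv_into UNIV \<gamma>) \<eta>)
      \<le> exp (\<epsilon> * (2 * real k + 2 - real n)) * vd \<xi> \<eta>"
    and "vd \<xi> \<eta> \<le> exp (\<epsilon> * (real n + 1 - 2 * real k))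
      * vd (bdry_map (inv_into UNIV \<gamma>) \<xi>) (bdry_map (inv_into UNIV \<gamma>) \<eta>)"
proof -
  have g: "\<gamma> \<in> \<Gamma>" "real n \<le> dist p (\<gamma> p)" "dist p (\<gamma> p) \<le> real n + 1"
    and bd: "\<xi> \<in> bdry" "\<eta> \<in> bdry" using assms by (auto simp: annulus_def level_def)
  let ?d = "vd (bdry_map (inv_into UNIV \<gamma>) \<xi>) (bdry_map (inv_into UNIV \<gamma>) \<eta>)"
  let ?b = "bE \<xi> (\<gamma> p) * bE \<eta> (\<gamma> p)"
  have lo: "exp (- \<epsilon> * (2 * real k + 2)) \<le> ?b"
  proof -
    have "exp (- \<epsilon> * (2 * real k + 2)) = exp (- \<epsilon> * (real k + 1)) * exp (- \<epsilon> * (real k + 1))"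
      by (simp only: exp_add[symmetric]) (simp add: algebra_simps)
    also have "\<dots> \<le> ?b" using assms by (intro mult_mono) (auto simp: level_def intro: less_imp_le[OF bE_pos])
    finally show ?thesis .
  qed
  have hi: "?b \<le> exp (- \<epsilon> * (2 * real k))"
  proof -
    have "?b \<le> exp (- \<epsilon> * real k) * exp (- \<epsilon> * real k)"
      using assms by (intro mult_mono) (auto simp: level_def intro: less_imp_le[OF bE_pos])
    also have "\<dots> = exp (- \<epsilon> * (2 * real k))"
      by (simp only: exp_add[symmetric]) (simp add: algebra_simps)
    finally show ?thesis .
  qed
  have eq: "?d = (exp (- \<epsilon> * dist p (\<gamma> p)) / ?b) * vd \<xi> \<eta>"
    using vd_inv[OF g(1) bd] by simp
  have "exp (- \<epsilon> * dist p (\<gamma> p)) / ?b \<le> exp (- \<epsilon> * real n) / exp (- \<epsilon> * (2 * real k + 2))"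
    using g(2) eps lo by (intro frac_le) auto
  also have "\<dots> = exp (\<epsilon> * (2 * real k + 2 - real n))"
    by (simp only: exp_diff[symmetric]) (simp add: algebra_simps)
  finally show "?d \<le> exp (\<epsilon> * (2 * real k + 2 - real n)) * vd \<xi> \<eta>"
    unfolding eq by (rule mult_right_mono) simp
  have "vd \<xi> \<eta> = (?b / exp (- \<epsilon> * dist p (\<gamma> p))) * ?d" using bE_pos[OF bd(1), of "\<gamma> p"] bE_pos[OF bd(2), of "\<gamma> p"] by (simp add: eq)
  also have "\<dots> \<le> exp (\<epsilon> * (real n + 1 - 2 * real k)) * ?d"
  proof (rule mult_right_mono)
    have "?b / exp (- \<epsilon> * dist p (\<gamma> p)) \<le> exp (- \<epsilon> * (2 * real k)) / exp (- \<epsilon> * (real n + 1))"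
      using g(3) eps hi by (intro frac_le) auto
    also have "\<dots> = exp (\<epsilon> * (real n + 1 - 2 * real k))"
      by (simp only: exp_diff[symmetric]) (simp add: algebra_simps)
    finally show "?b / exp (- \<epsilon> * dist p (\<gamma> p)) \<le> exp (\<epsilon> * (real n + 1 - 2 * real k))" .
  qed simp
  finally show "vd \<xi> \<eta> \<le> exp (\<epsilon> * (real n + 1 - 2 * real k)) * ?d" .
qed

lemma vd_inv_Lipschitz:
  assumes g: "\<gamma> \<in> \<Gamma>" and bd: "\<xi> \<in> bdry" "\<eta> \<in> bdry"
  shows "vd (bdry_map \<gamma> \<xi>) (bdry_map \<gamma> \<eta>) \<le> exp (\<epsilon> * dist p (\<gamma> p)) * vd \<xi> \<eta>"
proof -
  obtain u v where uv: "u \<in> \<xi>" "v \<in> \<eta>" using bdry_nonempty bd by blast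
  have "\<gamma> \<circ> u \<in> bdry_map \<gamma> \<xi>" "\<gamma> \<circ> v \<in> bdry_map \<gamma> \<eta>" using uv by (auto simp: bdry_map_def)
  from E_tendsto[OF bdry_map_in[OF g bd(1)] bdry_map_in[OF g bd(2)] this]
    tendsto_mult[OF tendsto_const E_tendsto[OF bd uv]]
  show ?thesis by (rule LIMSEQ_le) (use E_iso_le[OF g] in auto)
qed

end

section \<open>The Patterson--Sullivan measure\<close>

context strongly_hyperbolic_action
begin

abbreviation "\<alpha> \<equiv> volume_growth \<Gamma> p"
abbreviation "\<nu> \<equiv> patterson_sullivan \<Gamma> p \<epsilon>"

lemma sets_ps: "sets \<nu> = sigma_sets bdry {U. openin mtopology U}"
  by (simp add: patterson_sullivan_def Let_def sets_hausdorff_measure)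

lemma space_ps: "space \<nu> = bdry"
  by (simp add: patterson_sullivan_def Let_def space_scale_measure hausdorff_measure_def space_measure_of_conv)

lemma open_in_sets: "openin mtopology U \<Longrightarrow> U \<in> sets \<nu>"
  by (auto simp: sets_ps)

section \<open>Borel measurability\<close>

lemma measurable_bdry_map:
  assumes g: "\<gamma> \<in> \<Gamma>"
  shows "bdry_map \<gamma> \<in> measurable \<nu> \<nu>"
proof (rule measurable_sigma_sets[OF sets_ps])
  show "{U. openin mtopology U} \<subseteq> Pow bdry" using openin_subset[of mtopology] by auto
  show "bdry_map \<gamma> \<in> space \<nu> \<rightarrow> bdry" using bdry_map_in[OF g] by (simp add: space_ps)
  fix U assume "U \<in> {U. openin mtopology U}"
  then have U: "openin mtopology U" by simp
  have "openin mtopology (bdry_map \<gamma> -` U \<inter> bdry)"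
    unfolding openin_mtopology
  proof (intro conjI allI impI)
    fix \<xi> assume xi: "\<xi> \<in> bdry_map \<gamma> -` U \<inter> bdry"
    with U obtain r where r: "r > 0" "mball (bdry_map \<gamma> \<xi>) r \<subseteq> U" unfolding openin_mtopology by blast
    let ?L = "exp (\<epsilon> * dist p (\<gamma> p))"
    have "mball \<xi> (r / ?L) \<subseteq> bdry_map \<gamma> -` U \<inter> bdry"
    proof
      fix \<eta> assume eta: "\<eta> \<in> mball \<xi> (r / ?L)"
      have "vd (bdry_map \<gamma> \<xi>) (bdry_map \<gamma> \<eta>) \<le> ?L * vd \<xi> \<eta>"
        using vd_inv_Lipschitz[OF g] eta by simp
      also have "\<dots> < ?L * (r / ?L)" using eta by (intro mult_strict_left_mono) simp_all
      finally have "bdry_map \<gamma> \<eta> \<in> mball (bdry_map \<gamma> \<xi>) r"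
        using bdry_map_in[OF g] eta by simp
      then show "\<eta> \<in> bdry_map \<gamma> -` U \<inter> bdry" using r eta by auto
    qed
    then show "\<exists>r>0. mball \<xi> r \<subseteq> bdry_map \<gamma> -` U \<inter> bdry"
      using r(1) by (intro exI[of _ "r / ?L"]) simp
  qed simp
  then show "bdry_map \<gamma> -` U \<inter> space \<nu> \<in> sets \<nu>" by (simp add: open_in_sets space_ps)
qed

text \<open>The set is open because \<open>bE\<close> is 1-Lipschitz in its boundary
  argument.\<close>

lemma bE_greater_sets: "{\<xi> \<in> bdry. a < bE \<xi> x} \<in> sets \<nu>"
proof (rule open_in_sets, unfold openin_mtopology, intro conjI allI impI)
  fix \<xi> assume xi: "\<xi> \<in> {\<xi> \<in> bdry. a < bE \<xi> x}"
  have "mball \<xi> (bE \<xi> x - a) \<subseteq> {\<xi> \<in> bdry. a < bE \<xi> x}"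
    using bE_Lipschitz[of \<xi>, where x = x] by fastforce
  then show "\<exists>r>0. mball \<xi> r \<subseteq> {\<xi> \<in> bdry. a < bE \<xi> x}"
    using xi by (intro exI[of _ "bE \<xi> x - a"]) simp
qed simp

lemma level_sets: "level \<gamma> k \<in> sets \<nu>"
proof -
  have "level \<gamma> k = {\<xi> \<in> bdry. exp (- \<epsilon> * (real k + 1)) < bE \<xi> (\<gamma> p)} - {\<xi> \<in> bdry. exp (- \<epsilon> * real k) < bE \<xi> (\<gamma> p)}"
    by (auto simp: level_def)
  then show ?thesis using bE_greater_sets by simp
qed

lemma bdry_map_inv_image:
  assumes g: "\<gamma> \<in> \<Gamma>" and B: "B \<subseteq> bdry"
  shows "bdry_map (inv_into UNIV \<gamma>) ` B = bdry_map \<gamma> -` B \<inter> space \<nu>"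
proof (intro Set.set_eqI iffI)
  fix \<xi> assume "\<xi> \<in> bdry_map \<gamma> -` B \<inter> space \<nu>"
  then show "\<xi> \<in> bdry_map (inv_into UNIV \<gamma>) ` B"
    by (intro rev_image_eqI[of "bdry_map \<gamma> \<xi>"]) (simp_all add: bdry_map_inv[OF g])
qed (use B bdry_map_in[OF \<Gamma>_inv[OF g]] in \<open>auto simp: space_ps bdry_map_inv[OF g]\<close>)

text \<open>If the Hausdorff measure has total mass \<open>0\<close> or \<open>\<infinity>\<close>, or if the outer measure is not countably
  additive on the Borel sets (so that \<^const>\<open>measure_of\<close> returns the null measure), then the
  normalized measure is null. This also covers \<open>\<alpha> = 0\<close>, by
  \<open>hausdorff_outer_zero_exponent\<close>.\<close>

lemma ps_cases:
  obtains "emeasure \<nu> (space \<nu>) = 0"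
  | c where "\<alpha> > 0" "finite_measure \<nu>"
    "\<And>A. A \<in> sets \<nu> \<Longrightarrow> emeasure \<nu> A = c * hausdorff_outer bdry vd (\<alpha> / \<epsilon>) A"
proof -
  define H where "H = hausdorff_measure bdry vd (\<alpha> / \<epsilon>)"
  have nu: "\<nu> = scale_measure (1 / emeasure H (space H)) H"
    by (simp add: patterson_sullivan_def H_def Let_def)
  have sp: "space H = bdry" using space_ps by (simp add: nu space_scale_measure)
  show thesis
  proof (cases "emeasure H bdry = 0 \<or> emeasure H bdry = \<infinity>")
    case True
    \<comment> \<open>For total mass \<open>\<infinity>\<close> the scaling factor is 0. For total
      mass 0 the factor is \<open>\<infinity>\<close>, but its product with 0 is 0.\<close>
    then have "emeasure \<nu> (space \<nu>) = 0" unfolding space_ps by (auto simp: nu sp)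
    then show thesis by (rule that(1))
  next
    case False
    then have H: "emeasure H A = hausdorff_outer bdry vd (\<alpha> / \<epsilon>) A" if "A \<in> sets H" for A
      using emeasure_hausdorff_measure_cases[of "\<alpha> / \<epsilon>"] that unfolding H_def by metis
    have "\<alpha> \<noteq> 0"
      using False hausdorff_outer_zero_exponent H[of bdry] sets.top[of H] by (auto simp: sp)
    then have "\<alpha> > 0" using volume_growth_nonneg[of \<Gamma> p] by simp
    moreover have "finite_measure \<nu>"
      using False by (intro finite_measureI) (simp add: nu sp space_scale_measure ennreal_mult_eq_top_iff ennreal_divide_eq_top_iff)
    moreover have "emeasure \<nu> A = 1 / emeasure H bdry * hausdorff_outer bdry vd (\<alpha> / \<epsilon>) A" if "A \<in> sets \<nu>" for A
      using H that by (simp add: nu sp)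
    ultimately show thesis by (rule that(2))
  qed
qed

end

text \<open>The second alternative of \<open>ps_cases\<close>. The factor \<open>c\<close> stays
  abstract, since it occurs on both sides of every comparison of measures.\<close>

locale nontrivial_patterson_sullivan = strongly_hyperbolic_action +
  fixes c
  assumes \<alpha>_pos: "\<alpha> > 0" and fin: "finite_measure \<nu>"
    and em: "\<And>A. A \<in> sets \<nu> \<Longrightarrow> emeasure \<nu> A = c * hausdorff_outer bdry vd (\<alpha> / \<epsilon>) A"
begin

section \<open>Quasi-invariance of the measure\<close>

lemma inv_image_sets:
  assumes "\<gamma> \<in> \<Gamma>" "B \<in> sets \<nu>"
  shows "bdry_map (inv_into UNIV \<gamma>) ` B \<in> sets \<nu>"
  using measurable_sets[OF measurable_bdry_map[OF assms(1)] assms(2)] sets.sets_into_space[OF assms(2)]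
  by (subst bdry_map_inv_image[OF assms(1)]) (simp_all add: space_ps)

text \<open>On a level both \<open>\<gamma>\<close> and its inverse are Lipschitz with the factors
  of \<open>vd_inv_le\<close>. Raising a factor \<open>exp (\<epsilon> * t)\<close> to the dimension
  \<open>\<alpha> / \<epsilon>\<close> gives \<open>exp (\<alpha> * t)\<close>.\<close>

lemma emeasure_inv_image_le:
  assumes g: "\<gamma> \<in> annulus \<Gamma> p n 1" and B: "B \<in> sets \<nu>" "B \<subseteq> level \<gamma> k"
  shows "emeasure \<nu> (bdry_map (inv_into UNIV \<gamma>) ` B) \<le> ennreal (exp (\<alpha> * (2 * real k + 2 - real n))) * emeasure \<nu> B"
    and "emeasure \<nu> B \<le> ennreal (exp (\<alpha> * (real n + 1 - 2 * real k))) * emeasure \<nu> (bdry_map (inv_into UNIV \<gamma>) ` B)"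
proof -
  let ?i = "bdry_map (inv_into UNIV \<gamma>)"
  have G: "\<gamma> \<in> \<Gamma>" using g by (simp add: annulus_def)
  have Bb: "B \<subseteq> bdry" using B by (auto simp: level_def)
  have pw: "exp (\<epsilon> * t) powr (\<alpha> / \<epsilon>) = exp (\<alpha> * t)" for t
    using eps by (simp add: exp_powr_real)
  have D: "\<alpha> / \<epsilon> \<ge> 0" using \<alpha>_pos eps by simp
  have iB: "?i ` B \<subseteq> bdry" using bdry_map_in[OF \<Gamma>_inv[OF G]] Bb by blast
  have "hausdorff_outer bdry vd (\<alpha> / \<epsilon>) (?i ` B)
      \<le> ennreal (exp (\<epsilon> * (2 * real k + 2 - real n)) powr (\<alpha> / \<epsilon>)) * hausdorff_outer bdry vd (\<alpha> / \<epsilon>) B"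
  proof (rule hausdorff_outer_image_le)
    fix x y assume "x \<in> B" "y \<in> B"
    then show "vd (?i x) (?i y) \<le> exp (\<epsilon> * (2 * real k + 2 - real n)) * vd x y"
      using B(2) by (intro vd_inv_le(1)[OF g]) auto
  qed (use D iB in simp_all)
  then show "emeasure \<nu> (?i ` B) \<le> ennreal (exp (\<alpha> * (2 * real k + 2 - real n))) * emeasure \<nu> B"
    unfolding em[OF B(1)] em[OF inv_image_sets[OF G B(1)]] pw mult.left_commute[of _ c]
    by (rule mult_left_mono) simp
  have BB: "bdry_map \<gamma> ` (?i ` B) = B" by (simp add: image_image bdry_map_inv[OF G])
  have "hausdorff_outer bdry vd (\<alpha> / \<epsilon>) (bdry_map \<gamma> ` (?i ` B))
      \<le> ennreal (exp (\<epsilon> * (real n + 1 - 2 * real k)) powr (\<alpha> / \<epsilon>)) * hausdorff_outer bdry vd (\<alpha> / \<epsilon>) (?i ` B)"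
  proof (rule hausdorff_outer_image_le)
    fix x y assume "x \<in> ?i ` B" "y \<in> ?i ` B"
    then show "vd (bdry_map \<gamma> x) (bdry_map \<gamma> y) \<le> exp (\<epsilon> * (real n + 1 - 2 * real k)) * vd x y"
      using B(2) by (auto simp: bdry_map_inv[OF G] intro!: vd_inv_le(2)[OF g])
  qed (use D Bb in \<open>simp_all add: BB\<close>)
  then show "emeasure \<nu> B \<le> ennreal (exp (\<alpha> * (real n + 1 - 2 * real k))) * emeasure \<nu> (?i ` B)"
    unfolding BB em[OF B(1)] em[OF inv_image_sets[OF G B(1)]] pw mult.left_commute[of _ c]
    by (rule mult_left_mono) simp
qed

text \<open>Absolute continuity is needed first, so that \<open>RN_deriv\<close> is a density. It
  holds because a null set is cut into finitely many level pieces, each with a null preimage. The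
  bound then follows from \<open>AE_le_of_density_le\<close> on one level.\<close>

lemma RN_deriv_le:
  assumes g: "\<gamma> \<in> annulus \<Gamma> p n 1"
  shows "AE \<xi> in \<nu>. \<xi> \<in> level \<gamma> k \<longrightarrow>
    RN_deriv \<nu> (distr \<nu> \<nu> (bdry_map \<gamma>)) \<xi> \<le> ennreal (exp (\<alpha> * (2 * real k + 2 - real n)))"
proof -
  interpret finite_measure \<nu> by (rule fin)
  let ?i = "bdry_map (inv_into UNIV \<gamma>)" and ?N = "distr \<nu> \<nu> (bdry_map \<gamma>)"
  have G: "\<gamma> \<in> \<Gamma>" using g by (simp add: annulus_def)
  have N: "emeasure ?N B = emeasure \<nu> (?i ` B)" if "B \<in> sets \<nu>" for B
    using that sets.sets_into_space[OF that]
    by (simp add: emeasure_distr[OF measurable_bdry_map[OF G]] bdry_map_inv_image[OF G] space_ps)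
  have "absolutely_continuous \<nu> ?N"
    unfolding absolutely_continuous_def
  proof
    fix B assume "B \<in> null_sets \<nu>"
    then have B: "B \<in> sets \<nu>" "emeasure \<nu> B = 0" by auto
    have "?i ` (B \<inter> level \<gamma> k) \<in> null_sets \<nu>" for k
    proof (rule null_setsI)
      have *: "B \<inter> level \<gamma> k \<in> sets \<nu>" using B level_sets by blast
      show "?i ` (B \<inter> level \<gamma> k) \<in> sets \<nu>" by (rule inv_image_sets[OF G *])
      have "emeasure \<nu> (B \<inter> level \<gamma> k) = 0" using B by (metis emeasure_mono inf_le1 le_zero_eq)
      then show "emeasure \<nu> (?i ` (B \<inter> level \<gamma> k)) = 0"
        using emeasure_inv_image_le(1)[OF g *, of k] by simp
    qed
    then have "(\<Union>k\<in>{..n}. ?i ` (B \<inter> level \<gamma> k)) \<in> null_sets \<nu>" by (intro null_sets.finite_UN) auto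
    moreover have "?i ` B \<subseteq> (\<Union>k\<in>{..n}. ?i ` (B \<inter> level \<gamma> k))"
    proof
      fix \<eta> assume "\<eta> \<in> ?i ` B"
      then obtain \<xi> where xi: "\<xi> \<in> B" "\<eta> = ?i \<xi>" by blast
      moreover have "\<xi> \<in> bdry" using xi sets.sets_into_space[OF B(1)] by (auto simp: space_ps)
      ultimately show "\<eta> \<in> (\<Union>k\<in>{..n}. ?i ` (B \<inter> level \<gamma> k))" using level_cover[OF _ g] by blast
    qed
    ultimately have "emeasure \<nu> (?i ` B) = 0"
      by (metis (no_types, lifting) emeasure_mono le_zero_eq null_setsD1 null_setsD2)
    with N[OF B(1)] B(1) show "B \<in> null_sets ?N" by (intro null_setsI) simp_all
  qed
  then have "density \<nu> (RN_deriv \<nu> ?N) = ?N" by (rule density_RN_deriv) simp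
  then show ?thesis
    using emeasure_inv_image_le(1)[OF g] N
    by (intro AE_le_of_density_le[OF _ level_sets fin]) simp_all
qed

text \<open>A change of variables on one level, with the Jacobian replaced by an upper
  bound.\<close>

lemma nn_integral_level_le:
  assumes g: "\<gamma> \<in> annulus \<Gamma> p n 1" and h: "h \<in> borel_measurable \<nu>"
  shows "(\<integral>\<^sup>+\<xi>. indicator (level \<gamma> k) \<xi> * h (bdry_map (inv_into UNIV \<gamma>) \<xi>) \<partial>\<nu>)
    \<le> ennreal (exp (\<alpha> * (real n + 1 - 2 * real k))) *
      (\<integral>\<^sup>+\<xi>. indicator (bdry_map (inv_into UNIV \<gamma>) ` level \<gamma> k) \<xi> * h \<xi> \<partial>\<nu>)"
proof -
  let ?i = "bdry_map (inv_into UNIV \<gamma>)"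
  have G: "\<gamma> \<in> \<Gamma>" using g by (simp add: annulus_def)
  show ?thesis
  proof (rule nn_integral_indicator_comp_le[OF measurable_bdry_map[OF \<Gamma>_inv[OF G]] level_sets inv_image_sets[OF G level_sets] h])
    fix B assume B: "B \<in> sets \<nu>"
    have "level \<gamma> k \<inter> ?i -` B = level \<gamma> k \<inter> (?i -` B \<inter> space \<nu>)" by (auto simp: level_def space_ps)
    then have *: "level \<gamma> k \<inter> ?i -` B \<in> sets \<nu>"
      using level_sets measurable_sets[OF measurable_bdry_map[OF \<Gamma>_inv[OF G]] B] by simp
    have "?i ` (level \<gamma> k \<inter> ?i -` B) = ?i ` level \<gamma> k \<inter> B" by blast
    with emeasure_inv_image_le(2)[OF g *, of k]
    show "emeasure \<nu> (level \<gamma> k \<inter> ?i -` B) \<le> ennreal (exp (\<alpha> * (real n + 1 - 2 * real k))) * emeasure \<nu> (?i ` level \<gamma> k \<inter> B)"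
      by simp
  qed
qed

end

section \<open>The operator bound\<close>

context strongly_hyperbolic_action
begin

lemma bdry_rep_sum_measurable:
  assumes f: "\<And>\<gamma>. f \<gamma> \<noteq> 0 \<Longrightarrow> \<gamma> \<in> \<Gamma>" and v: "v \<in> borel_measurable \<nu>"
  shows "bdry_rep_sum \<nu> s f v \<in> borel_measurable \<nu>"
proof -
  have "(\<lambda>\<xi>. v (bdry_map (inv_into UNIV \<gamma>) \<xi>)) \<in> borel_measurable \<nu>" if "f \<gamma> \<noteq> 0" for \<gamma>
    by (rule measurable_compose[OF measurable_bdry_map[OF \<Gamma>_inv[OF f[OF that]]] v])
  then show ?thesis
    unfolding bdry_rep_sum_def[abs_def] bdry_rep_def by (intro borel_measurable_sum) simp
qed

end

context nontrivial_patterson_sullivan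
begin

text \<open>The derivative contributes at most \<open>exp (s * \<alpha> * (2 * k - n))\<close> on
  level \<open>k\<close>, up to \<open>exp (2 * \<alpha>)\<close>. Half a power of it, moved into
  \<open>g k\<close>, balances the change of variables, so all \<open>g k\<close> share one L2
  bound; the rest is the weight \<open>w k\<close>.\<close>

lemma bdry_rep_sum_bound:
  assumes fin_f: "finite {\<gamma>. f \<gamma> \<noteq> 0}" and sub: "{\<gamma>. f \<gamma> \<noteq> 0} \<subseteq> annulus \<Gamma> p n 1"
    and s: "s \<in> {0..1}" and v: "v \<in> L2 \<nu>"
    and N: "\<And>k \<eta> \<gamma>'. k \<le> n \<Longrightarrow> \<eta> \<in> bdry \<Longrightarrow> \<gamma>' \<in> annulus \<Gamma> p n 1 \<Longrightarrow>
      finite (level_fibre n k \<gamma>' \<eta>) \<and> card (level_fibre n k \<gamma>' \<eta>) \<le> N"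
  shows "bdry_rep_sum \<nu> s f v \<in> L2 \<nu> \<and> L2_norm \<nu> (bdry_rep_sum \<nu> s f v)
    \<le> exp (2 * \<alpha>) * sqrt (exp \<alpha> * real N) * (\<Sum>k\<le>n. exp ((s - 1/2) * \<alpha> * (2 * real k - real n)))
        * L2_set (\<lambda>\<gamma>. cmod (f \<gamma>)) {\<gamma>. f \<gamma> \<noteq> 0} * L2_norm \<nu> v"
proof -
  define S where "S = {\<gamma>. f \<gamma> \<noteq> 0}"
  define F where "F = (\<Sum>\<gamma>\<in>S. (cmod (f \<gamma>))\<^sup>2)"
  define V where "V = (\<integral>\<xi>. (cmod (v \<xi>))\<^sup>2 \<partial>\<nu>)"
  define w where "w k = exp ((s - 1/2) * \<alpha> * (2 * real k - real n))" for k
  define W where "W = (\<Sum>k\<le>n. w k)"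
  define u where "u \<xi> = cmod (v \<xi>)" for \<xi>
  define i where "i \<gamma> = bdry_map (inv_into UNIV \<gamma> :: 'a \<Rightarrow> 'a)" for \<gamma> :: "'a \<Rightarrow> 'a"
  define G where "G k \<xi> = (\<Sum>\<gamma>\<in>S. cmod (f \<gamma>) * (indicator (level \<gamma> k) \<xi> * u (i \<gamma> \<xi>)))" for k \<xi>
  define g where "g k \<xi> = exp (\<alpha> * (2 * real k - real n) / 2) * G k \<xi>" for k \<xi>
  let ?T = "bdry_rep_sum \<nu> s f v"
  let ?RN = "\<lambda>\<gamma>. RN_deriv \<nu> (distr \<nu> \<nu> (bdry_map \<gamma>))"
  have S: "finite S" "S \<subseteq> annulus \<Gamma> p n 1" using fin_f sub by (simp_all add: S_def)
  have S\<Gamma>: "\<gamma> \<in> \<Gamma>" if "\<gamma> \<in> S" for \<gamma> using that S by (auto simp: annulus_def)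
  have vm: "v \<in> borel_measurable \<nu>" and vi: "integrable \<nu> (\<lambda>\<xi>. (cmod (v \<xi>))\<^sup>2)" using v by (simp_all add: L2_def)
  have um: "u \<in> borel_measurable \<nu>" unfolding u_def[abs_def] using vm by measurable
  have im: "i \<gamma> \<in> measurable \<nu> \<nu>" if "\<gamma> \<in> S" for \<gamma>
    unfolding i_def by (rule measurable_bdry_map[OF \<Gamma>_inv[OF S\<Gamma>[OF that]]])
  have Gm: "G k \<in> borel_measurable \<nu>" for k
    unfolding G_def[abs_def]
    by (intro borel_measurable_sum borel_measurable_times borel_measurable_const borel_measurable_indicator
        level_sets measurable_compose[OF im um])
  have gm: "g k \<in> borel_measurable \<nu>" for k
    unfolding g_def[abs_def] using Gm by measurable
  have V: "(\<integral>\<^sup>+\<xi>. ennreal ((u \<xi>)\<^sup>2) \<partial>\<nu>) = ennreal V"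
    unfolding V_def u_def by (rule nn_integral_eq_integral[OF vi]) simp
  have F0: "F \<ge> 0" and V0: "V \<ge> 0" and W0: "W \<ge> 0"
    by (auto simp: F_def V_def W_def w_def intro!: sum_nonneg)
  have g_le: "(\<integral>\<^sup>+\<xi>. ennreal ((g k \<xi>)\<^sup>2) \<partial>\<nu>) \<le> ennreal (exp \<alpha> * N * F * V)" if k: "k \<in> {..n}" for k
  proof -
    have "(\<integral>\<^sup>+\<xi>. ennreal ((G k \<xi>)\<^sup>2) \<partial>\<nu>)
      \<le> ennreal (exp (\<alpha> * (real n + 1 - 2 * real k))) * of_nat N * ennreal F * (\<integral>\<^sup>+\<xi>. ennreal ((u \<xi>)\<^sup>2) \<partial>\<nu>)"
      unfolding G_def F_def
    proof (rule nn_integral_sum_square_le[OF S(1) im level_sets _ um,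
          where A' = "\<lambda>\<gamma>. i \<gamma> ` level \<gamma> k" and P = "\<lambda>\<gamma> \<gamma>'. E (\<gamma> p) (\<gamma>' p) \<le> 2 * exp (- \<epsilon> * real k)"])
      show "i \<gamma> ` level \<gamma> k \<in> sets \<nu>" if "\<gamma> \<in> S" for \<gamma>
        unfolding i_def by (rule inv_image_sets[OF S\<Gamma>[OF that] level_sets])
      show "(\<integral>\<^sup>+\<xi>. indicator (level \<gamma> k) \<xi> * h (i \<gamma> \<xi>) \<partial>\<nu>)
        \<le> ennreal (exp (\<alpha> * (real n + 1 - 2 * real k))) * (\<integral>\<^sup>+\<xi>. indicator (i \<gamma> ` level \<gamma> k) \<xi> * h \<xi> \<partial>\<nu>)"
        if "\<gamma> \<in> S" "h \<in> borel_measurable \<nu>" for \<gamma> h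
        unfolding i_def using that S by (intro nn_integral_level_le) auto
      show "E (\<gamma>' p) (\<gamma> p) \<le> 2 * exp (- \<epsilon> * real k)" if "\<xi> \<in> level \<gamma> k" "\<xi> \<in> level \<gamma>' k" for \<gamma> \<gamma>' \<xi>
        using E_le_of_common_level[OF that(2,1)] .
      fix \<gamma>' \<eta> assume g': "\<gamma>' \<in> S" and eta: "\<eta> \<in> space \<nu>"
      \<comment> \<open>That \<open>\<eta>\<close> is the preimage under \<open>\<gamma>\<close> of
        a point of level \<open>k\<close> means that \<open>\<gamma>\<close> maps
        \<open>\<eta>\<close> into that level, as the fibre demands.\<close>
      have "{\<gamma> \<in> S. E (\<gamma> p) (\<gamma>' p) \<le> 2 * exp (- \<epsilon> * real k) \<and> \<eta> \<in> i \<gamma> ` level \<gamma> k} \<subseteq> level_fibre n k \<gamma>' \<eta>"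
        using S(2) S\<Gamma> by (auto simp: i_def bdry_map_inv level_fibre_def)
      moreover have "k \<le> n" "\<eta> \<in> bdry" "\<gamma>' \<in> annulus \<Gamma> p n 1" using k eta g' S(2) by (auto simp: space_ps)
      note N[OF this]
      ultimately show "card {\<gamma> \<in> S. E (\<gamma> p) (\<gamma>' p) \<le> 2 * exp (- \<epsilon> * real k) \<and> \<eta> \<in> i \<gamma> ` level \<gamma> k} \<le> N"
        by (meson card_mono order_trans)
    qed
    also have "\<dots> = ennreal (exp (\<alpha> * (real n + 1 - 2 * real k)) * N * F * V)"
      unfolding V using F0 V0 by (simp add: ennreal_mult ennreal_of_nat_eq_real_of_nat)
    finally have "ennreal (exp (\<alpha> * (2 * real k - real n))) * (\<integral>\<^sup>+\<xi>. ennreal ((G k \<xi>)\<^sup>2) \<partial>\<nu>)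
        \<le> ennreal (exp (\<alpha> * (2 * real k - real n))) * ennreal (exp (\<alpha> * (real n + 1 - 2 * real k)) * N * F * V)"
      by (rule mult_left_mono) simp
    also have "\<dots> = ennreal ((exp (\<alpha> * (2 * real k - real n)) * exp (\<alpha> * (real n + 1 - 2 * real k))) * N * F * V)"
      using F0 V0 by (simp add: ennreal_mult[symmetric] mult.assoc)
    also have "exp (\<alpha> * (2 * real k - real n)) * exp (\<alpha> * (real n + 1 - 2 * real k)) = exp \<alpha>"
      by (simp add: exp_add[symmetric] algebra_simps)
    finally have "ennreal (exp (\<alpha> * (2 * real k - real n))) * (\<integral>\<^sup>+\<xi>. ennreal ((G k \<xi>)\<^sup>2) \<partial>\<nu>) \<le> ennreal (exp \<alpha> * N * F * V)" .
    moreover have "ennreal ((g k \<xi>)\<^sup>2) = ennreal (exp (\<alpha> * (2 * real k - real n))) * ennreal ((G k \<xi>)\<^sup>2)" for \<xi>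
      by (simp add: g_def power_mult_distrib ennreal_mult[symmetric] exp_double[symmetric])
    ultimately show ?thesis
      using Gm by (simp add: nn_integral_cmult)
  qed
  have RN: "AE \<xi> in \<nu>. \<forall>\<gamma>\<in>S. \<forall>k\<in>{..n}. \<xi> \<in> level \<gamma> k \<longrightarrow> ?RN \<gamma> \<xi> \<le> ennreal (exp (\<alpha> * (2 * real k + 2 - real n)))"
    using S by (intro AE_finite_allI RN_deriv_le) auto
  have pt: "AE \<xi> in \<nu>. cmod (?T \<xi>) \<le> exp (2 * \<alpha>) * (\<Sum>k\<le>n. w k * g k \<xi>)"
    using RN
  proof (rule AE_mp, intro AE_I2 impI)
    fix \<xi> assume xi: "\<xi> \<in> space \<nu>"
      and RN: "\<forall>\<gamma>\<in>S. \<forall>k\<in>{..n}. \<xi> \<in> level \<gamma> k \<longrightarrow> ?RN \<gamma> \<xi> \<le> ennreal (exp (\<alpha> * (2 * real k + 2 - real n)))"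
    have term_le: "cmod (f \<gamma> * bdry_rep \<nu> s \<gamma> v \<xi>) \<le> exp (2 * \<alpha>) *
        (\<Sum>k\<le>n. exp (s * \<alpha> * (2 * real k - real n)) * (cmod (f \<gamma>) * (indicator (level \<gamma> k) \<xi> * u (i \<gamma> \<xi>))))" (is "_ \<le> _ * (\<Sum>k\<le>n. ?t k)")
      if g: "\<gamma> \<in> S" for \<gamma>
    proof -
      obtain k where k: "k \<le> n" "\<xi> \<in> level \<gamma> k" using level_cover[of \<xi> \<gamma> n] xi g S(2) by (auto simp: space_ps)
      have "enn2real (?RN \<gamma> \<xi>) \<le> exp (\<alpha> * (2 * real k + 2 - real n))"
        using RN g k by (intro enn2real_leI) auto
      \<comment> \<open>Here \<open>s \<ge> 0\<close> makes the power monotone; below,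
        \<open>s \<le> 1\<close> bounds \<open>exp (2 * \<alpha> * s)\<close> uniformly in
        \<open>s\<close>.\<close>
      then have "enn2real (?RN \<gamma> \<xi>) powr s \<le> exp (\<alpha> * (2 * real k + 2 - real n)) powr s"
        using s by (intro powr_mono2) auto
      also have "\<dots> = exp (2 * \<alpha> * s) * exp (s * \<alpha> * (2 * real k - real n))"
        by (simp add: exp_powr_real exp_add[symmetric] algebra_simps)
      also have "\<dots> \<le> exp (2 * \<alpha>) * exp (s * \<alpha> * (2 * real k - real n))"
        using s \<alpha>_pos by (intro mult_right_mono) auto
      finally have "enn2real (?RN \<gamma> \<xi>) powr s * (cmod (f \<gamma>) * u (i \<gamma> \<xi>)) \<le>
          exp (2 * \<alpha>) * exp (s * \<alpha> * (2 * real k - real n)) * (cmod (f \<gamma>) * u (i \<gamma> \<xi>))"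
        by (rule mult_right_mono) (simp add: u_def)
      also have "\<dots> = exp (2 * \<alpha>) * ?t k" using k by simp
      also have "\<dots> \<le> exp (2 * \<alpha>) * (\<Sum>k\<le>n. ?t k)"
        using k by (intro mult_left_mono member_le_sum) (auto simp: u_def)
      finally show ?thesis by (simp add: bdry_rep_def norm_mult i_def u_def mult_ac)
    qed
    have "cmod (?T \<xi>) \<le> (\<Sum>\<gamma>\<in>S. cmod (f \<gamma> * bdry_rep \<nu> s \<gamma> v \<xi>))"
      unfolding bdry_rep_sum_def S_def by (rule norm_sum)
    also have "\<dots> \<le> (\<Sum>\<gamma>\<in>S. exp (2 * \<alpha>) *
        (\<Sum>k\<le>n. exp (s * \<alpha> * (2 * real k - real n)) * (cmod (f \<gamma>) * (indicator (level \<gamma> k) \<xi> * u (i \<gamma> \<xi>)))))"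
      by (rule sum_mono[OF term_le])
    also have "\<dots> = exp (2 * \<alpha>) * (\<Sum>k\<le>n. exp (s * \<alpha> * (2 * real k - real n)) * G k \<xi>)"
      unfolding G_def sum_distrib_left by (rule sum.swap)
    also have "(\<Sum>k\<le>n. exp (s * \<alpha> * (2 * real k - real n)) * G k \<xi>) = (\<Sum>k\<le>n. w k * g k \<xi>)"
    proof (rule sum.cong[OF refl])
      fix k
      have "exp (s * \<alpha> * (2 * real k - real n)) = w k * exp (\<alpha> * (2 * real k - real n) / 2)"
        unfolding w_def exp_add[symmetric] by (rule arg_cong[where f = exp]) (simp add: field_simps)
      then show "exp (s * \<alpha> * (2 * real k - real n)) * G k \<xi> = w k * g k \<xi>" by (simp add: g_def)
    qed
    finally show "cmod (?T \<xi>) \<le> exp (2 * \<alpha>) * (\<Sum>k\<le>n. w k * g k \<xi>)" .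
  qed
  define B where "B = (exp (2 * \<alpha>))\<^sup>2 * (W\<^sup>2 * (exp \<alpha> * N * F * V))"
  have Tm: "?T \<in> borel_measurable \<nu>" using bdry_rep_sum_measurable[OF _ vm] S\<Gamma> by (simp add: S_def)
  have "(\<integral>\<^sup>+\<xi>. ennreal ((cmod (?T \<xi>))\<^sup>2) \<partial>\<nu>) \<le> (\<integral>\<^sup>+\<xi>. ennreal ((exp (2 * \<alpha>))\<^sup>2) * ennreal ((\<Sum>k\<le>n. w k * g k \<xi>)\<^sup>2) \<partial>\<nu>)"
    using pt
  proof (intro nn_integral_mono_AE, elim AE_mp, intro AE_I2 impI)
    fix \<xi> assume "cmod (?T \<xi>) \<le> exp (2 * \<alpha>) * (\<Sum>k\<le>n. w k * g k \<xi>)"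
    then have "(cmod (?T \<xi>))\<^sup>2 \<le> (exp (2 * \<alpha>) * (\<Sum>k\<le>n. w k * g k \<xi>))\<^sup>2" by (rule power_mono) simp
    then show "ennreal ((cmod (?T \<xi>))\<^sup>2) \<le> ennreal ((exp (2 * \<alpha>))\<^sup>2) * ennreal ((\<Sum>k\<le>n. w k * g k \<xi>)\<^sup>2)"
      by (simp add: ennreal_mult[symmetric] power_mult_distrib ennreal_leI)
  qed
  also have "\<dots> = ennreal ((exp (2 * \<alpha>))\<^sup>2) * (\<integral>\<^sup>+\<xi>. ennreal ((\<Sum>k\<le>n. w k * g k \<xi>)\<^sup>2) \<partial>\<nu>)"
    using gm by (intro nn_integral_cmult) measurable
  also have "\<dots> \<le> ennreal ((exp (2 * \<alpha>))\<^sup>2) * (ennreal ((\<Sum>k\<le>n. w k)\<^sup>2) * ennreal (exp \<alpha> * N * F * V))"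
    by (intro mult_left_mono nn_integral_weighted_sum_square_le g_le gm) (auto simp: w_def)
  also have "\<dots> = ennreal B"
    using F0 V0 by (simp add: B_def W_def ennreal_mult[symmetric])
  finally have le: "(\<integral>\<^sup>+\<xi>. ennreal ((cmod (?T \<xi>))\<^sup>2) \<partial>\<nu>) \<le> ennreal B" .
  have B0: "B \<ge> 0" using F0 V0 by (simp add: B_def)
  have int: "integrable \<nu> (\<lambda>\<xi>. (cmod (?T \<xi>))\<^sup>2)"
    using Tm le by (intro integrableI_bounded) (auto intro: le_less_trans)
  have "ennreal (\<integral>\<xi>. (cmod (?T \<xi>))\<^sup>2 \<partial>\<nu>) \<le> ennreal B"
    using le by (simp add: nn_integral_eq_integral[OF int])
  then have "(\<integral>\<xi>. (cmod (?T \<xi>))\<^sup>2 \<partial>\<nu>) \<le> B" using B0 by simp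
  then have "L2_norm \<nu> ?T \<le> sqrt B" by (simp add: L2_norm_def)
  also have "sqrt B = exp (2 * \<alpha>) * sqrt (exp \<alpha> * N) * W * sqrt F * sqrt V"
    using W0 by (simp add: B_def real_sqrt_mult)
  finally show ?thesis
    using int Tm by (simp add: L2_def W_def w_def F_def V_def L2_norm_def L2_set_def S_def)
qed

end

theorem theorem1p2:
  fixes p :: "'a::metric_space" and \<Gamma> :: "('a \<Rightarrow> 'a) set" and \<epsilon> :: real
  assumes "proper_space TYPE('a)"
    and "roughly_geodesic TYPE('a)"
    and "\<epsilon> > 0" and "strongly_hyperbolic TYPE('a) \<epsilon>"
    and "isometry_group \<Gamma>"
    and "properly_discontinuous \<Gamma>"
    and "cocompact \<Gamma>"
    and "non_elementary \<Gamma> p"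
  shows "\<exists>R>0. \<exists>C>0. \<forall>s\<in>{0..1}. \<forall>(n::nat) (f :: ('a \<Rightarrow> 'a) \<Rightarrow> complex).
    finite {\<gamma>. f \<gamma> \<noteq> 0} \<longrightarrow> {\<gamma>. f \<gamma> \<noteq> 0} \<subseteq> annulus \<Gamma> p n R \<longrightarrow>
    op_norm (patterson_sullivan \<Gamma> p \<epsilon>) (bdry_rep_sum (patterson_sullivan \<Gamma> p \<epsilon>) s f)
      \<le> ereal (C * (1 + omega (volume_growth \<Gamma> p) \<bar>s - 1/2\<bar> (real n * R))
          * L2_set (\<lambda>\<gamma>. cmod (f \<gamma>)) {\<gamma>. f \<gamma> \<noteq> 0})"
proof -
  interpret strongly_hyperbolic_action p \<Gamma> \<epsilon>
    by unfold_locales (use assms in auto)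
  show ?thesis
  proof (cases rule: ps_cases)
    case 1
    \<comment> \<open>All L2 norms vanish for a null measure, so measurability of the image
      functions is enough and both constants can be 1.\<close>
    show ?thesis
    proof (intro exI[of _ "1::real"] conjI ballI allI impI op_norm_le)
      fix s :: real and n and f :: "('a \<Rightarrow> 'a) \<Rightarrow> complex" and v
      assume sub: "{\<gamma>. f \<gamma> \<noteq> 0} \<subseteq> annulus \<Gamma> p n 1" and v: "v \<in> L2 \<nu>"
      have "bdry_rep_sum \<nu> s f v \<in> borel_measurable \<nu>"
        using sub v by (intro bdry_rep_sum_measurable) (auto simp: annulus_def L2_def)
      note this[THEN L2_of_null_measure(1)[OF 1]] this[THEN L2_of_null_measure(2)[OF 1]]
      moreover have "L2_norm \<nu> v = 0" using v by (intro L2_of_null_measure(2)[OF 1]) (simp add: L2_def)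
      ultimately show "bdry_rep_sum \<nu> s f v \<in> L2 \<nu>"
        "L2_norm \<nu> (bdry_rep_sum \<nu> s f v) \<le> 1 * (1 + omega \<alpha> \<bar>s - 1/2\<bar> (real n * 1)) *
          L2_set (\<lambda>\<gamma>. cmod (f \<gamma>)) {\<gamma>. f \<gamma> \<noteq> 0} * L2_norm \<nu> v"
        by simp_all
    qed (auto intro!: mult_nonneg_nonneg add_nonneg_nonneg omega_nonneg volume_growth_nonneg)
  next
    case (2 c)
    interpret nontrivial_patterson_sullivan p \<Gamma> \<epsilon> c
      by (intro nontrivial_patterson_sullivan.intro nontrivial_patterson_sullivan_axioms.intro
          strongly_hyperbolic_action_axioms 2)
    obtain N where N: "\<And>n k \<eta> \<gamma>'. k \<le> n \<Longrightarrow> \<eta> \<in> bdry \<Longrightarrow> \<gamma>' \<in> annulus \<Gamma> p n 1 \<Longrightarrow>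
      finite (level_fibre n k \<gamma>' \<eta>) \<and> card (level_fibre n k \<gamma>' \<eta>) \<le> N"
      using card_level_fibre_le[OF assms(1,2,6,7)] by blast
    \<comment> \<open>The summand 1 keeps \<open>C\<close> positive even if
      \<open>N = 0\<close>.\<close>
    define C where "C = exp (2 * \<alpha>) * sqrt (exp \<alpha> * real N) + 1"
    have C: "C > 0" by (simp add: C_def add_nonneg_pos)
    \<comment> \<open>With \<open>R = 1\<close> the annuli are as wide as the levels, so the levels
      \<open>k \<le> n\<close> cover the boundary and \<open>sum_weights_le\<close> adds up their
      weights.\<close>
    show ?thesis
    proof (rule exI[of _ "1::real"], rule conjI[OF zero_less_one], rule exI[of _ C],
        intro conjI ballI allI impI op_norm_le)
      fix s :: real and n and f :: "('a \<Rightarrow> 'a) \<Rightarrow> complex" and v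
      assume s: "s \<in> {0..1}" and f: "finite {\<gamma>. f \<gamma> \<noteq> 0}" "{\<gamma>. f \<gamma> \<noteq> 0} \<subseteq> annulus \<Gamma> p n 1" and v: "v \<in> L2 \<nu>"
      note bd = bdry_rep_sum_bound[OF f s v N[of _ n]]
      show "bdry_rep_sum \<nu> s f v \<in> L2 \<nu>" using bd by blast
      have "exp (2 * \<alpha>) * sqrt (exp \<alpha> * real N) * (\<Sum>k\<le>n. exp ((s - 1/2) * \<alpha> * (2 * real k - real n)))
          \<le> C * (1 + omega \<alpha> \<bar>s - 1/2\<bar> (real n * 1))"
        using sum_weights_le[OF \<alpha>_pos, of "s - 1/2" n] C
        by (intro mult_mono) (auto simp: C_def intro!: sum_nonneg)
      then have "exp (2 * \<alpha>) * sqrt (exp \<alpha> * real N) * (\<Sum>k\<le>n. exp ((s - 1/2) * \<alpha> * (2 * real k - real n)))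
          * L2_set (\<lambda>\<gamma>. cmod (f \<gamma>)) {\<gamma>. f \<gamma> \<noteq> 0} * L2_norm \<nu> v
          \<le> C * (1 + omega \<alpha> \<bar>s - 1/2\<bar> (real n * 1)) * L2_set (\<lambda>\<gamma>. cmod (f \<gamma>)) {\<gamma>. f \<gamma> \<noteq> 0} * L2_norm \<nu> v"
        by (intro mult_right_mono) (auto simp: L2_norm_def)
      with bd show "L2_norm \<nu> (bdry_rep_sum \<nu> s f v) \<le> C * (1 + omega \<alpha> \<bar>s - 1/2\<bar> (real n * 1)) *
          L2_set (\<lambda>\<gamma>. cmod (f \<gamma>)) {\<gamma>. f \<gamma> \<noteq> 0} * L2_norm \<nu> v"
        by linarith
    qed (use C in \<open>auto intro!: mult_nonneg_nonneg add_nonneg_nonneg omega_nonneg volume_growth_nonneg\<close>)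
  qed
qed

end
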